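(* Let $c_1,c_2$ be real constants and consider the fractional-order Lagrange system with controls $$D_t^q x^1=x^2x^3+c_1x^1,\qquad D_t^q x^2=x^1x^3+c_2x^2,\qquad D_t^q x^3=x^1x^2+c_2x^3,$$ and its equilibrium state $e_0=(0,0,0)$. (i) If $c_1<0$ and $c_2<0$, then $e_0$ is asymptotically stable for all $q\in(0,1)$. (ii) If $c_1>0$ and $c_2>0$, or if $c_1c_2<0$, then $e_0$ is unstable for all $q\in(0,1)$.
   Context: Superscripts on $x$ denote components, not powers. For $0<q<1$, $D_t^q$ is the Caputo derivative $D_t^q f(t)=\frac{1}{\Gamma(1-q)}\int_0^t (t-s)^{-q}f'(s)\,ds$; solutions with $x(0)=x_0$ of a system $D_t^q x=f(x)$ are understood as continuous solutions of $x(t)=x_0+\frac{1}{\Gamma(q)}\int_0^t (t-s)^{q-1}f(x(s))\,ds$. An equilibrium state $x_e$ (a point with $f(x_e)=0$) is stable if for every $\varepsilon>0$ there is $\delta>0$ such that every solution with $\|x(0)-x_e\|<\delta$ exists for all $t\ge 0$ and satisfies $\|x(t)-x_e\|<\varepsilon$ for all $t\ge0$; it is (locally) asymptotically stable if it is stable and there is $\delta_0>0$ such that $\lim_{t\to\infty}\|x(t)-x_e\|=0$ whenever $\|x(0)-x_e\|<\delta_0$; it is unstable if it is not stable. *)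

theory Defs
  imports "HOL-Analysis.Analysis"
begin

text \<open>
  A solution of the Caputo system \<open>D\<^sub>t\<^sup>q x = f(x)\<close>, \<open>0 < q < 1\<close>, on an interval \<open>J\<close> starting at
  \<open>0\<close> is a continuous solution of the equivalent Volterra integral equation. The interval may be
  bounded, half-open, unbounded, or the degenerate interval \<open>{0}\<close>; values of \<open>x\<close> outside \<open>J\<close> are
  irrelevant. The integrand is absolutely integrable whenever \<open>f \<circ> x\<close> is continuous; its
  value at \<open>s = t\<close>, where the kernel is singular, is \<open>0\<close> by the convention \<open>0 powr a = 0\<close>.
\<close>

definition caputo_solution_on ::
    "real \<Rightarrow> ('a::euclidean_space \<Rightarrow> 'a) \<Rightarrow> real set \<Rightarrow> (real \<Rightarrow> 'a) \<Rightarrow> bool" where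
  "caputo_solution_on q f J x \<longleftrightarrow>
     is_interval J \<and> 0 \<in> J \<and> J \<subseteq> {0..} \<and> continuous_on J x \<and>
     (\<forall>t\<in>J. x t = x 0 + (1 / Gamma q) *\<^sub>R
        integral {0..t} (\<lambda>s. (t - s) powr (q - 1) *\<^sub>R f (x s)))"

definition equilibrium :: "('a::euclidean_space \<Rightarrow> 'a) \<Rightarrow> 'a \<Rightarrow> bool" where
  "equilibrium f xe \<longleftrightarrow> f xe = 0"

text \<open>
  ``Every solution starting near \<open>xe\<close> exists for all \<open>t \<ge> 0\<close> and stays near \<open>xe\<close>'' is rendered as:
  every solution on an interval \<open>J\<close> extends to a solution on \<open>{0..}\<close> that stays near \<open>xe\<close>.
  For \<open>J = {0..}\<close> this bounds every global solution, and for \<open>J = {0}\<close> it asserts that a global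
  solution exists for every initial value near \<open>xe\<close>, so the condition is never vacuous.
\<close>

definition stable_equilibrium ::
    "real \<Rightarrow> ('a::euclidean_space \<Rightarrow> 'a) \<Rightarrow> 'a \<Rightarrow> bool" where
  "stable_equilibrium q f xe \<longleftrightarrow> equilibrium f xe \<and>
     (\<forall>\<epsilon>>0. \<exists>\<delta>>0. \<forall>J x. caputo_solution_on q f J x \<and> norm (x 0 - xe) < \<delta> \<longrightarrow>
        (\<exists>y. caputo_solution_on q f {0..} y \<and> (\<forall>t\<in>J. y t = x t) \<and>
             (\<forall>t\<ge>0. norm (y t - xe) < \<epsilon>)))"

definition asymptotically_stable_equilibrium ::
    "real \<Rightarrow> ('a::euclidean_space \<Rightarrow> 'a) \<Rightarrow> 'a \<Rightarrow> bool" where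
  "asymptotically_stable_equilibrium q f xe \<longleftrightarrow> stable_equilibrium q f xe \<and>
     (\<exists>\<delta>\<^sub>0>0. \<forall>x. caputo_solution_on q f {0..} x \<and> norm (x 0 - xe) < \<delta>\<^sub>0 \<longrightarrow>
        ((\<lambda>t. norm (x t - xe)) \<longlongrightarrow> 0) at_top)"

definition unstable_equilibrium ::
    "real \<Rightarrow> ('a::euclidean_space \<Rightarrow> 'a) \<Rightarrow> 'a \<Rightarrow> bool" where
  "unstable_equilibrium q f xe \<longleftrightarrow> equilibrium f xe \<and> \<not> stable_equilibrium q f xe"

definition controlled_lagrange :: "real \<Rightarrow> real \<Rightarrow> real ^ 3 \<Rightarrow> real ^ 3" where
  "controlled_lagrange c1 c2 x = vector
     [x $ 2 * x $ 3 + c1 * x $ 1,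
      x $ 1 * x $ 3 + c2 * x $ 2,
      x $ 1 * x $ 2 + c2 * x $ 3]"

end

theory Submission imports Defs begin

text \<open>
  Everything rests on a maximum principle for the Riemann--Liouville integral \<open>I\<close> of order \<open>q\<close>:
  if \<open>w = I H\<close> is nonpositive on \<open>(0,a)\<close> and \<open>H \<le> 0\<close> on \<open>[a,t)\<close>, then \<open>w t \<le> 0\<close>. Although the
  equation has memory, the contribution of the past, \<open>\<integral>\<^sub>0\<^sup>a (t-s)\<^bsup>q-1\<^esup> H s ds\<close>, is an average of \<open>w\<close>
  over \<open>(0,a)\<close> with a positive weight (balayage of the Abel kernel). Hence a solution cannot leave a
  region through a boundary at which the vector field points inwards, even if the region moves.

  For negative \<open>c\<^sub>1\<close>, \<open>c\<^sub>2\<close> the small boxes \<open>\<bar>x\<^sup>i\<bar> \<le> M\<close> are invariant, which gives global existence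
  (by truncating the vector field) and stability. Comparison with the moving box \<open>\<bar>x\<^sup>i\<bar> \<le> C t\<^bsup>-\<beta>\<^esup>\<close>,
  where \<open>\<beta> = q (1 - q)\<close>, gives attractivity. If some \<open>c\<^sub>i\<close> is positive, then a coordinate axis is
  invariant and the system restricted to it is \<open>D\<^sup>q u = c\<^sub>i u\<close>, whose nonzero solutions are unbounded.
\<close>


section \<open>The Riemann--Liouville integral and its maximum principle\<close>

text \<open>A Lebesgue rather than a gauge integral, so that Fubini and dominated convergence apply.
  The interval is open because the densities used below may be singular at \<open>0\<close>, like
  s^(-q).\<close>

definition riemann_liouville :: "real \<Rightarrow> (real \<Rightarrow> 'a::euclidean_space) \<Rightarrow> real \<Rightarrow> 'a" where
  "riemann_liouville q H t = (1 / Gamma q) *\<^sub>R (LBINT s:{0<..<t}. (t - s) powr (q - 1) *\<^sub>R H s)"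

text \<open>Has to be tracked separately, since the Lebesgue integral of a non-integrable function
  is \<open>0\<close> by convention.\<close>

definition riemann_liouville_integrable :: "real \<Rightarrow> (real \<Rightarrow> 'a::euclidean_space) \<Rightarrow> real \<Rightarrow> bool" where
  "riemann_liouville_integrable q H t \<longleftrightarrow>
     set_integrable lborel {0<..<t} (\<lambda>s. (t - s) powr (q - 1) *\<^sub>R H s)"

section \<open>Beta integrals and the balayage identity for the Abel kernel\<close>

lemma set_integral_open_interval:
  fixes f :: "real \<Rightarrow> real"
  assumes "set_integrable lborel {a..b} f"
  shows "set_integrable lborel {a<..<b} f"
    and "(LBINT s:{a<..<b}. f s) = (LBINT s:{a..b}. f s)"
proof -
  show *: "set_integrable lborel {a<..<b} f"
    by (rule set_integrable_subset[OF assms]) auto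
  show "(LBINT s:{a<..<b}. f s) = (LBINT s:{a..b}. f s)"
    using set_borel_integral_eq_integral(2)[OF *] set_borel_integral_eq_integral(2)[OF assms]
    by (simp add: integral_open_interval_real)
qed

text \<open>Euler's Beta integral under a nondecreasing change of variables. It is applied to the
  scaling s / t, for powers, and to a Moebius map, for the balayage kernel.\<close>

lemma Beta_substitution:
  fixes g g' :: "real \<Rightarrow> real"
  assumes "\<alpha> > 0" "\<beta> > 0" "c \<le> d" "g c = 0" "g d = 1"
    and "\<And>x. x \<in> {c..d} \<Longrightarrow> (g has_real_derivative g' x) (at x)"
    and "continuous_on {c..d} g'"
    and "\<And>x. x \<in> {c..d} \<Longrightarrow> g' x \<ge> 0"
  defines "h \<equiv> (\<lambda>x. g x powr (\<alpha> - 1) * (1 - g x) powr (\<beta> - 1) * g' x)"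
  shows "set_integrable lborel {c<..<d} h" and "(LBINT s:{c<..<d}. h s) = Beta \<alpha> \<beta>"
proof -
  let ?f = "\<lambda>x::real. x powr (\<alpha> - 1) * (1 - x) powr (\<beta> - 1)"
  have int: "set_integrable lborel {g c..g d} ?f"
    using integrable_Beta[OF assms(1,2)] assms(4,5) by simp
  have 1: "set_integrable lborel {c..d} h"
    unfolding h_def using integral_substitution(1)[OF int assms(6,7,8,3)] by simp
  have "(LBINT s:{c..d}. h s) = (LBINT x:{0..1}. ?f x)"
    using integral_substitution(2)[OF int assms(6,7,8,3)] assms(4,5)
    by (simp add: h_def set_lebesgue_integral_def mult.commute)
  also have "\<dots> = Beta \<alpha> \<beta>"
    using set_borel_integral_eq_integral(2)[OF integrable_Beta[OF assms(1,2)]]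
      has_integral_Beta_real[OF assms(1,2)] by (simp add: integral_unique)
  finally show "(LBINT s:{c<..<d}. h s) = Beta \<alpha> \<beta>"
    using set_integral_open_interval[OF 1] by simp
  show "set_integrable lborel {c<..<d} h"
    using set_integral_open_interval[OF 1] by simp
qed

text \<open>Scaling by t reduces the integral to Beta (1 - p) q. For p = q the result is constant in
  t, which is how constants are represented as Riemann-Liouville integrals; p > q yields decaying
  comparison functions.\<close>

lemma riemann_liouville_powr:
  assumes "q > 0" "p < 1" "t > 0"
  shows "riemann_liouville_integrable q (\<lambda>s. s powr (- p)) t"
    and "riemann_liouville q (\<lambda>s. s powr (- p)) t = Gamma (1 - p) / Gamma (1 + q - p) * t powr (q - p)"
proof -
  let ?h = "\<lambda>s. (s / t) powr ((1 - p) - 1) * (1 - s / t) powr (q - 1) * (1 / t)"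
  have d: "((\<lambda>s. s / t) has_real_derivative 1 / t) (at s)" for s
    using assms(3) by (auto intro!: derivative_eq_intros)
  have 0: "set_integrable lborel {0<..<t} ?h" "(LBINT s:{0<..<t}. ?h s) = Beta (1 - p) q"
    using Beta_substitution[of "1 - p" q 0 t "\<lambda>s. s / t" "\<lambda>_. 1 / t"] assms d by auto
  have eq: "(t - s) powr (q - 1) * s powr (- p) = t powr (q - p) * ?h s" if "s \<in> {0<..<t}" for s
  proof -
    have "1 - s / t = (t - s) / t" using assms(3) by (simp add: diff_divide_distrib)
    then have "?h s = s powr (- p) * (t - s) powr (q - 1) / (t powr (- p) * t powr (q - 1) * t powr 1)"
      using that assms by (simp add: powr_divide)
    also have "t powr (- p) * t powr (q - 1) * t powr 1 = t powr (q - p)"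
      unfolding powr_add [symmetric] by (rule arg_cong[of _ _ "(powr) t"]) simp
    finally show ?thesis using assms by simp
  qed
  have "set_integrable lborel {0<..<t} (\<lambda>s. t powr (q - p) * ?h s)"
    by (rule set_integrable_mult_right) (use 0 in simp)
  then show "riemann_liouville_integrable q (\<lambda>s. s powr (- p)) t"
    unfolding riemann_liouville_integrable_def real_scaleR_def
    by (subst set_integrable_cong[OF refl refl eq]) auto
  have "(LBINT s:{0<..<t}. (t - s) powr (q - 1) * s powr (- p))
      = (LBINT s:{0<..<t}. t powr (q - p) * ?h s)"
    by (rule set_lebesgue_integral_cong) (use eq in auto)
  also have "\<dots> = t powr (q - p) * (LBINT s:{0<..<t}. ?h s)"
    by (rule set_integral_mult_right)
  finally have "(LBINT s:{0<..<t}. (t - s) powr (q - 1) * s powr (- p)) = t powr (q - p) * Beta (1 - p) q"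
    unfolding 0(2) .
  then show "riemann_liouville q (\<lambda>s. s powr (- p)) t = Gamma (1 - p) / Gamma (1 + q - p) * t powr (q - p)"
    using Gamma_real_pos[OF assms(1)] by (simp add: riemann_liouville_def Beta_def algebra_simps)
qed

text \<open>
  The substitution is the Moebius transformation mapping \<open>s\<close>, \<open>a\<close>, \<open>t\<close> to \<open>0\<close>, \<open>1\<close>, \<open>\<infinity>\<close>.
\<close>

lemma balayage_kernel:
  fixes q s a t :: real
  assumes q: "0 < q" "q < 1" and st: "s < a" "a < t"
  defines "m \<equiv> (\<lambda>\<tau>. (\<tau> - s) powr (q - 1) * (a - \<tau>) powr (- q) / (t - \<tau>))"
  shows "set_integrable lborel {s<..<a} m"
    and "(LBINT \<tau>:{s<..<a}. m \<tau>) = Beta q (1 - q) * (t - a) powr (- q) * (t - s) powr (q - 1)"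
proof -
  let ?g = "\<lambda>\<tau>::real. (\<tau> - s) * (t - a) / ((a - s) * (t - \<tau>))"
  let ?g' = "\<lambda>\<tau>. (t - a) * (t - s) / ((a - s) * (t - \<tau>)^2)"
  let ?h = "\<lambda>\<tau>. ?g \<tau> powr (q - 1) * (1 - ?g \<tau>) powr ((1 - q) - 1) * ?g' \<tau>"
  let ?C = "(t - a) powr (- q) * (t - s) powr (q - 1)"
  have d: "(?g has_real_derivative ?g' \<tau>) (at \<tau>)" if "\<tau> \<in> {s..a}" for \<tau>
    using that st
    by (auto intro!: derivative_eq_intros simp: divide_simps power2_eq_square) (simp add: algebra_simps)
  have c: "continuous_on {s..a} ?g'"
    using st by (intro continuous_intros) auto
  have 0: "set_integrable lborel {s<..<a} ?h" "(LBINT s:{s<..<a}. ?h s) = Beta q (1 - q)"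
    using Beta_substitution[of q "1 - q" s a ?g ?g'] q st d c by auto
  have eq: "m \<tau> = ?C * ?h \<tau>" if "\<tau> \<in> {s<..<a}" for \<tau>
  proof -
    have *: "1 - ?g \<tau> = (a - \<tau>) * (t - s) / ((a - s) * (t - \<tau>))"
      using that st by (simp add: divide_simps) (simp add: algebra_simps)
    \<comment> \<open>Naming the six lengths turns the identity into one between products of powers
      of positive atoms.\<close>
    define A B D E F where defs: "A = \<tau> - s" "B = t - a" "D = a - s" "E = t - \<tau>" "F = t - s"
    define G where "G = a - \<tau>"
    have pos: "A > 0" "B > 0" "D > 0" "E > 0" "F > 0" "G > 0"
      using that st by (auto simp: defs G_def)
    have "?h \<tau> = (A * B / (D * E)) powr (q - 1) * (G * F / (D * E)) powr (- q) * (B * F / (D * E^2))"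
      using * by (simp add: defs G_def)
    also have "\<dots> = A powr (q - 1) * B powr q * G powr (- q) * F powr (1 - q) / E"
      using pos by (simp add: powr_divide powr_mult powr_diff powr_minus_divide power2_eq_square field_simps)
    finally show ?thesis
      using pos by (simp add: m_def powr_diff powr_minus_divide flip: defs G_def)
  qed
  have "set_integrable lborel {s<..<a} (\<lambda>\<tau>. ?C * ?h \<tau>)"
    by (rule set_integrable_mult_right) (use 0 in simp)
  then show "set_integrable lborel {s<..<a} m"
    by (subst set_integrable_cong[OF refl refl eq]) auto
  have "(LBINT \<tau>:{s<..<a}. m \<tau>) = (LBINT \<tau>:{s<..<a}. ?C * ?h \<tau>)"
    by (rule set_lebesgue_integral_cong) (use eq in auto)
  also have "\<dots> = ?C * (LBINT \<tau>:{s<..<a}. ?h \<tau>)"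
    by (rule set_integral_mult_right)
  finally show "(LBINT \<tau>:{s<..<a}. m \<tau>) = Beta q (1 - q) * (t - a) powr (- q) * (t - s) powr (q - 1)"
    using 0 by simp
qed

section \<open>The maximum principle\<close>

text \<open>Integrate the values of \<open>riemann_liouville q H\<close> at \<tau> in (0,a) against
  the positive weight (a - \<tau>)^(-q) / (t - \<tau>) and exchange the integrals: by
  \<open>balayage_kernel\<close> the inner integral over \<tau> is a positive constant times (t -
  s)^(q-1). So the past contribution is a positive multiple of an integral of nonpositive
  values.\<close>

lemma balayage_nonpos:
  assumes q: "0 < q" "q < 1" and at: "0 < a" "a < t"
    and H: "continuous_on {0<..} H" "riemann_liouville_integrable q H t"
    and le: "\<And>\<tau>. \<tau> \<in> {0<..<a} \<Longrightarrow> riemann_liouville q H \<tau> \<le> 0"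
  shows "(LBINT s:{0<..<a}. (t - s) powr (q - 1) * H s) \<le> 0"
proof -
  \<comment> \<open>\<open>H\<close> is only known to be continuous on the positive reals; the
    extension by \<open>0\<close> is Borel on the whole line, as Fubini requires.\<close>
  define H' where "H' s = indicat_real {0<..} s *\<^sub>R H s" for s
  have [measurable]: "H' \<in> borel_measurable borel"
    unfolding H'_def by (rule borel_measurable_continuous_on_indicator) (use H in auto)
  define m where "m s \<tau> = (\<tau> - s) powr (q - 1) * (a - \<tau>) powr (- q) / (t - \<tau>)" for s \<tau>
  \<comment> \<open>The indicators cut out the triangle 0 < s < \<tau> < a, so both iterated
    integrals can run over the whole line.\<close>
  define K where "K s \<tau> = indicator {0<..<a} s * indicator {0<..<a} \<tau> * indicator {0<..} (\<tau> - s) * m s \<tau> * H' s" for s \<tau>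
  define C where "C = Beta q (1 - q) * (t - a) powr (- q)"
  have C: "C > 0"
    unfolding C_def Beta_def using q at by (auto intro!: mult_pos_pos divide_pos_pos Gamma_real_pos)
  have Gq: "Gamma q > 0" using q by simp
  have meas: "(\<lambda>(s, \<tau>). K s \<tau>) \<in> borel_measurable (lborel \<Otimes>\<^sub>M lborel)"
    unfolding K_def m_def by measurable
  have K1: "K s \<tau> = indicator {s<..<a} \<tau> *\<^sub>R (m s \<tau> * H s)" if "s \<in> {0<..<a}" for s \<tau>
    using that by (auto simp: K_def H'_def indicator_def)
  have K0: "K s \<tau> = 0" if "s \<notin> {0<..<a}" for s \<tau>
    using that by (auto simp: K_def)
  have int\<tau>: "integrable lborel (K s)" for s
  proof (cases "s \<in> {0<..<a}")
    case True
    then have "set_integrable lborel {s<..<a} (m s)"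
      using balayage_kernel(1)[OF q _ at(2), of s] by (simp add: m_def [abs_def])
    then have "set_integrable lborel {s<..<a} (\<lambda>\<tau>. m s \<tau> * H s)"
      by simp
    moreover have "K s = (\<lambda>\<tau>. indicator {s<..<a} \<tau> *\<^sub>R (m s \<tau> * H s))"
      using K1[OF True] by auto
    ultimately show ?thesis by (simp add: set_integrable_def)
  next
    case False
    then have "K s = (\<lambda>_. 0)" using K0 by auto
    then show ?thesis by simp
  qed
  have val: "(\<integral>\<tau>. K s \<tau> \<partial>lborel) = indicator {0<..<a} s *\<^sub>R (C * ((t - s) powr (q - 1) * H s))" for s
  proof (cases "s \<in> {0<..<a}")
    case True
    then have "(\<integral>\<tau>. K s \<tau> \<partial>lborel) = (LBINT \<tau>:{s<..<a}. m s \<tau> * H s)"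
      unfolding set_lebesgue_integral_def by (intro Bochner_Integration.integral_cong refl K1)
    also have "\<dots> = (LBINT \<tau>:{s<..<a}. m s \<tau>) * H s"
      by (rule set_integral_mult_left)
    also have "(LBINT \<tau>:{s<..<a}. m s \<tau>) = C * (t - s) powr (q - 1)"
      using balayage_kernel(2)[OF q _ at(2), of s] True by (simp add: m_def C_def)
    finally show ?thesis using True by simp
  qed (simp add: K0)
  have nval: "(\<integral>\<tau>. norm (K s \<tau>) \<partial>lborel) = \<bar>indicator {0<..<a} s *\<^sub>R (C * ((t - s) powr (q - 1) * H s))\<bar>" for s
  proof (cases "s \<in> {0<..<a}")
    case True
    \<comment> \<open>The weight is nonnegative on the triangle, so only the sign of
      \<open>H s\<close> matters and the integral of the norm follows from
      \<open>val\<close>.\<close>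
    have "norm (K s \<tau>) = K s \<tau> * sgn (H s)" for \<tau>
      using True at by (auto simp: K1 [OF True] m_def indicator_def abs_mult sgn_if)
    then show ?thesis using val[of s] C True by (simp add: abs_mult) (simp add: abs_sgn)
  qed (simp add: K0)
  have int: "set_integrable lborel {0<..<a} (\<lambda>s. (t - s) powr (q - 1) * H s)"
    by (rule set_integrable_subset[OF H(2)[unfolded riemann_liouville_integrable_def real_scaleR_def]]) (use at in auto)
  have "integrable (lborel \<Otimes>\<^sub>M lborel) (\<lambda>(s, \<tau>). K s \<tau>)"
  proof (rule lborel_pair.Fubini_integrable[OF meas])
    have "set_integrable lborel {0<..<a} (\<lambda>s. C * ((t - s) powr (q - 1) * H s))"
      by (rule set_integrable_mult_right) (use int in simp)
    then show "integrable lborel (\<lambda>x. LBINT y. norm (case (x, y) of (s, \<tau>) \<Rightarrow> K s \<tau>))"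
      unfolding set_integrable_def by (simp add: nval[unfolded real_norm_def])
    show "AE x in lborel. integrable lborel (\<lambda>y. case (x, y) of (s, \<tau>) \<Rightarrow> K s \<tau>)"
      using int\<tau> by simp
  qed
  then have "(\<integral>\<tau>. (\<integral>s. K s \<tau> \<partial>lborel) \<partial>lborel) = (\<integral>s. (\<integral>\<tau>. K s \<tau> \<partial>lborel) \<partial>lborel)"
    by (rule lborel_pair.Fubini_integral)
  also have "\<dots> = (LBINT s:{0<..<a}. C * ((t - s) powr (q - 1) * H s))"
    by (simp only: val set_lebesgue_integral_def)
  also have "\<dots> = C * (LBINT s:{0<..<a}. (t - s) powr (q - 1) * H s)"
    by (rule set_integral_mult_right)
  finally have *: "C * (LBINT s:{0<..<a}. (t - s) powr (q - 1) * H s) = (\<integral>\<tau>. (\<integral>s. K s \<tau> \<partial>lborel) \<partial>lborel)" ..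
  \<comment> \<open>In the other order of integration, each \<tau> in (0,a) gives a positive
    multiple of \<open>riemann_liouville q H \<tau>\<close>.\<close>
  have "(\<integral>s. K s \<tau> \<partial>lborel) \<le> 0" for \<tau>
  proof (cases "\<tau> \<in> {0<..<a}")
    case True
    have "(\<integral>s. K s \<tau> \<partial>lborel)
        = (LBINT s:{0<..<\<tau>}. ((a - \<tau>) powr (- q) / (t - \<tau>)) * ((\<tau> - s) powr (q - 1) * H s))"
      unfolding set_lebesgue_integral_def
      by (rule Bochner_Integration.integral_cong)
         (use True in \<open>auto simp: K_def m_def H'_def indicator_def\<close>)
    also have "\<dots> = ((a - \<tau>) powr (- q) / (t - \<tau>)) * (Gamma q * riemann_liouville q H \<tau>)"
      using Gq by (subst set_integral_mult_right) (simp add: riemann_liouville_def)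
    also have "\<dots> \<le> 0"
      using le[OF True] Gq True at
      by (intro mult_nonneg_nonpos[OF _ mult_nonneg_nonpos]) (auto intro!: divide_nonneg_pos)
    finally show ?thesis .
  qed (auto simp: K_def)
  then have "0 \<le> (\<integral>\<tau>. - (\<integral>s. K s \<tau> \<partial>lborel) \<partial>lborel)"
    by (intro integral_nonneg_AE) auto
  then have "C * (LBINT s:{0<..<a}. (t - s) powr (q - 1) * H s) \<le> 0"
    unfolding * by simp
  then show ?thesis
    using C by (metis mult_le_0_iff not_less)
qed

text \<open>Split the integral at \<open>a\<close>: the past part is nonpositive by
  \<open>balayage_nonpos\<close>, the recent part because its integrand is.\<close>

lemma riemann_liouville_barrier:
  fixes H :: "real \<Rightarrow> real"
  assumes q: "0 < q" "q < 1" and at: "0 < a" "a < t"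
    and H: "continuous_on {0<..} H" "riemann_liouville_integrable q H t"
    and le: "\<And>\<tau>. \<tau> \<in> {0<..<a} \<Longrightarrow> riemann_liouville q H \<tau> \<le> 0"
    and neg: "\<And>s. s \<in> {a..<t} \<Longrightarrow> H s \<le> 0"
  shows "riemann_liouville q H t \<le> 0"
proof -
  let ?f = "\<lambda>s. (t - s) powr (q - 1) * H s"
  have un: "{0<..<t} = {0<..<a} \<union> {a..<t}" using at by auto
  have int: "set_integrable lborel {0<..<t} ?f"
    using H(2) by (simp add: riemann_liouville_integrable_def)
  have "(LBINT s:{0<..<t}. ?f s) = (LBINT s:{0<..<a}. ?f s) + (LBINT s:{a..<t}. ?f s)"
    unfolding un by (rule set_integral_Un) (use at in \<open>auto intro!: set_integrable_subset[OF int]\<close>)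
  moreover have "(LBINT s:{0<..<a}. ?f s) \<le> 0"
    by (rule balayage_nonpos[OF q at H le])
  moreover have "0 \<le> (LBINT s:{a..<t}. - ?f s)"
    unfolding set_lebesgue_integral_def using neg
    by (intro integral_nonneg_AE AE_I2) (auto simp: indicator_def intro!: mult_nonneg_nonpos)
  moreover have "(LBINT s:{a..<t}. - ?f s) = - (LBINT s:{a..<t}. ?f s)"
    by (rule set_integral_uminus) (use at in \<open>auto intro!: set_integrable_subset[OF int]\<close>)
  ultimately show ?thesis
    using q by (simp add: riemann_liouville_def divide_le_0_iff not_less)
qed

text \<open>Let \<open>a\<close> be the infimum of the times at which some component is positive. By
  continuity all components are nonpositive at \<open>a\<close>. One that vanishes there has
  \<open>H < 0\<close> at \<open>a\<close> and shortly after, so the barrier lemma keeps it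
  nonpositive; a negative one stays negative by continuity. With finitely many components this
  contradicts the choice of \<open>a\<close>. The initial stretch up to \<open>T\<close> keeps the
  argument away from \<open>0\<close>, where \<open>H\<close> may be singular.\<close>

lemma riemann_liouville_family_nonpos:
  fixes H w :: "'i \<Rightarrow> real \<Rightarrow> real"
  assumes q: "0 < q" "q < 1" and "finite I" and T: "0 < T"
    and H: "\<And>i. i \<in> I \<Longrightarrow> continuous_on {0<..} (H i)"
      "\<And>i t. i \<in> I \<Longrightarrow> t > 0 \<Longrightarrow> riemann_liouville_integrable q (H i) t"
    and w: "\<And>i t. i \<in> I \<Longrightarrow> t > 0 \<Longrightarrow> w i t = riemann_liouville q (H i) t"
      "\<And>i. i \<in> I \<Longrightarrow> continuous_on {0<..} (w i)"
    and init: "\<And>i t. i \<in> I \<Longrightarrow> t \<in> {0<..T} \<Longrightarrow> w i t \<le> 0"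
    and neg: "\<And>i t. \<lbrakk>i \<in> I; t \<ge> T; w i t = 0; \<And>j. j \<in> I \<Longrightarrow> w j t \<le> 0\<rbrakk> \<Longrightarrow> H i t < 0"
    and "i \<in> I" "t > 0"
  shows "w i t \<le> 0"
proof (rule ccontr)
  assume "\<not> w i t \<le> 0"
  define S where "S = {s. s > 0 \<and> (\<exists>i\<in>I. w i s > 0)}"
  define a where "a = Inf S"
  have tS: "t \<in> S" using \<open>\<not> w i t \<le> 0\<close> \<open>i \<in> I\<close> \<open>t > 0\<close> by (force simp: S_def not_le)
  have ST: "s > T" if "s \<in> S" for s
    using that init by (force simp: S_def not_le)
  have bdd: "bdd_below S" using ST by (intro bdd_belowI[of _ T]) (auto dest: less_imp_le)
  have aT: "a \<ge> T" unfolding a_def using tS ST by (intro cInf_greatest) (auto dest: less_imp_le)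
  have a0: "a > 0" using aT T by simp
  have below: "w j s \<le> 0" if "j \<in> I" "s \<in> {0<..<a}" for j s
    using cInf_lower[OF _ bdd, of s] that by (force simp: S_def a_def not_le)
  have isCont: "isCont f a" if "continuous_on {0<..} f" for f :: "real \<Rightarrow> real"
    using that a0 by (meson continuous_on_eq_continuous_at greaterThan_iff open_greaterThan)
  have ata: "w j a \<le> 0" if j: "j \<in> I" for j
  proof (rule tendsto_upperbound)
    show "(w j \<longlongrightarrow> w j a) (at_left a)"
      using isCont[OF w(2)[OF j]] by (auto simp: isCont_def intro: tendsto_mono[OF at_le])
    show "\<forall>\<^sub>F s in at_left a. w j s \<le> 0"
      unfolding eventually_at_left_field using a0 below[OF j] by (intro exI[of _ 0]) auto
  qed simp
  have "\<forall>\<^sub>F s in at_right a. w j s \<le> 0" if j: "j \<in> I" for j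
  proof (cases "w j a = 0")
    case True
    have "H j a < 0"
      by (rule neg[OF j aT True]) (use ata in auto)
    then have "\<forall>\<^sub>F s in at a. H j s < 0"
      using isCont[OF H(1)[OF j]] unfolding isCont_def by (rule order_tendstoD[rotated])
    then have "\<forall>\<^sub>F s in at_right a. H j s < 0"
      by (rule filter_leD[OF at_le, rotated]) simp
    then obtain b where b: "b > a" "\<And>s. a < s \<Longrightarrow> s < b \<Longrightarrow> H j s < 0"
      unfolding eventually_at_right_field by blast
    have "w j s \<le> 0" if "a < s" "s < b" for s
    proof -
      have "H j r \<le> 0" if "r \<in> {a..<s}" for r
        using b(2)[of r] \<open>H j a < 0\<close> that \<open>s < b\<close> by (cases "r = a") auto
      moreover have "riemann_liouville q (H j) r \<le> 0" if "r \<in> {0<..<a}" for r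
        using below[OF j that] w(1)[OF j, of r] that by simp
      ultimately show ?thesis
        using riemann_liouville_barrier[OF q a0 \<open>a < s\<close> H(1)[OF j] H(2)[OF j]] w(1)[OF j, of s] a0 \<open>a < s\<close>
        by simp
    qed
    then show ?thesis unfolding eventually_at_right_field using b(1) by blast
  next
    case False
    then have "w j a < 0" using ata[OF j] by simp
    then have "\<forall>\<^sub>F s in at a. w j s < 0"
      using isCont[OF w(2)[OF j]] unfolding isCont_def by (rule order_tendstoD[rotated])
    then have "\<forall>\<^sub>F s in at_right a. w j s < 0"
      by (rule filter_leD[OF at_le, rotated]) simp
    then show ?thesis by (rule eventually_mono) simp
  qed
  then have "\<forall>\<^sub>F s in at_right a. \<forall>j\<in>I. w j s \<le> 0"
    using \<open>finite I\<close> by (simp add: eventually_ball_finite)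
  then obtain b where b: "b > a" "\<And>s j. a < s \<Longrightarrow> s < b \<Longrightarrow> j \<in> I \<Longrightarrow> w j s \<le> 0"
    unfolding eventually_at_right_field by blast
  have "s \<ge> b" if "s \<in> S" for s
  proof (rule ccontr)
    assume "\<not> b \<le> s"
    moreover have "s \<ge> a" unfolding a_def using cInf_lower[OF that bdd] .
    ultimately show False
      using that b(2)[of s] ata by (cases "s = a") (force simp: S_def)+
  qed
  then have "a \<ge> b" unfolding a_def using tS by (intro cInf_greatest) auto
  then show False using b by simp
qed

section \<open>Integrability, linearity and monotonicity\<close>

lemma riemann_liouville_0 [simp]: "riemann_liouville q H 0 = 0"
  by (simp add: riemann_liouville_def set_lebesgue_integral_def)

lemma riemann_liouville_kernel_integrable:
  fixes q t b :: real
  assumes "q > 0"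
  shows "set_integrable lborel {0<..<t} (\<lambda>s. (t - s) powr (q - 1) * b)"
proof (cases "t > 0")
  case True
  have "set_integrable lborel {0<..<t} (\<lambda>s. (t - s) powr (q - 1) * s powr 0)"
    using riemann_liouville_powr(1)[of q 0 t] True assms by (simp add: riemann_liouville_integrable_def)
  then have "set_integrable lborel {0<..<t} (\<lambda>s. (t - s) powr (q - 1))"
    by (rule set_integrable_cong[THEN iffD1, rotated -1]) auto
  then show ?thesis by simp
qed (simp add: set_integrable_def)

lemma riemann_liouville_integrable_bounded:
  fixes \<phi> :: "real \<Rightarrow> 'a::euclidean_space"
  assumes "q > 0" "set_borel_measurable lborel {0<..<t} \<phi>"
    and "\<And>s. s \<in> {0<..<t} \<Longrightarrow> norm (\<phi> s) \<le> B"
  shows "riemann_liouville_integrable q \<phi> t"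
  unfolding riemann_liouville_integrable_def
proof (rule set_integrable_bound[OF riemann_liouville_kernel_integrable[OF assms(1), of t B]])
  have "(\<lambda>s. (t - s) powr (q - 1) *\<^sub>R (indicat_real {0<..<t} s *\<^sub>R \<phi> s)) \<in> borel_measurable lborel"
    using assms(2) unfolding set_borel_measurable_def by measurable
  then show "set_borel_measurable lborel {0<..<t} (\<lambda>s. (t - s) powr (q - 1) *\<^sub>R \<phi> s)"
    by (simp add: set_borel_measurable_def mult.commute)
  show "AE s in lborel. s \<in> {0<..<t} \<longrightarrow> norm ((t - s) powr (q - 1) *\<^sub>R \<phi> s) \<le> norm ((t - s) powr (q - 1) * B)"
    using assms(3) by (auto simp: abs_mult intro!: AE_I2 mult_left_mono order_trans[OF assms(3)])
qed

lemma riemann_liouville_integrable_continuous: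
  fixes \<phi> :: "real \<Rightarrow> 'a::euclidean_space"
  assumes "q > 0" "continuous_on {0..t} \<phi>"
  shows "riemann_liouville_integrable q \<phi> t"
proof -
  have "bounded (\<phi> ` {0..t})"
    by (intro compact_imp_bounded compact_continuous_image assms(2)) auto
  then obtain B where "\<And>s. s \<in> {0..t} \<Longrightarrow> norm (\<phi> s) \<le> B"
    unfolding bounded_iff by blast
  moreover have "set_borel_measurable lborel {0<..<t} \<phi>"
    unfolding set_borel_measurable_def measurable_lborel2
    by (rule borel_measurable_continuous_on_indicator)
       (auto intro: continuous_on_subset[OF assms(2)])
  ultimately show ?thesis
    using assms(1) by (intro riemann_liouville_integrable_bounded[where B = B]) auto
qed

lemma riemann_liouville_eq_integral:
  assumes "riemann_liouville_integrable q \<phi> t"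
  shows "riemann_liouville q \<phi> t
    = (1 / Gamma q) *\<^sub>R integral {0..t} (\<lambda>s. (t - s) powr (q - 1) *\<^sub>R \<phi> s)"
  using set_borel_integral_eq_integral(2)[OF assms[unfolded riemann_liouville_integrable_def]]
  by (simp add: riemann_liouville_def integral_open_interval_real)

lemma riemann_liouville_integrable_add:
  assumes "riemann_liouville_integrable q f t" "riemann_liouville_integrable q g t"
  shows "riemann_liouville_integrable q (\<lambda>s. f s + g s) t"
    and "riemann_liouville q (\<lambda>s. f s + g s) t = riemann_liouville q f t + riemann_liouville q g t"
  using assms unfolding riemann_liouville_integrable_def riemann_liouville_def
  by (simp_all add: scaleR_add_right set_integral_add)

lemma riemann_liouville_integrable_diff:
  assumes "riemann_liouville_integrable q f t" "riemann_liouville_integrable q g t"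
  shows "riemann_liouville_integrable q (\<lambda>s. f s - g s) t"
    and "riemann_liouville q (\<lambda>s. f s - g s) t = riemann_liouville q f t - riemann_liouville q g t"
  using assms unfolding riemann_liouville_integrable_def riemann_liouville_def
  by (simp_all add: scaleR_diff_right set_integral_diff)

text \<open>Serves for coordinate projections, for scalar factors and for the sign symmetry in the
  instability proof.\<close>

lemma riemann_liouville_linear:
  fixes f :: "real \<Rightarrow> 'a::euclidean_space" and T :: "'a \<Rightarrow> 'b::euclidean_space"
  assumes "riemann_liouville_integrable q f t" "linear T"
  shows "riemann_liouville_integrable q (\<lambda>s. T (f s)) t"
    and "riemann_liouville q (\<lambda>s. T (f s)) t = T (riemann_liouville q f t)"
proof -
  interpret T: bounded_linear T using assms(2) by (simp add: linear_conv_bounded_linear)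
  let ?g = "\<lambda>s. indicat_real {0<..<t} s *\<^sub>R (t - s) powr (q - 1) *\<^sub>R f s"
  have int: "integrable lborel ?g"
    using assms(1) by (simp add: riemann_liouville_integrable_def set_integrable_def)
  have "integrable lborel (\<lambda>s. T (?g s))"
    by (rule integrable_bounded_linear[OF T.bounded_linear_axioms int])
  then show "riemann_liouville_integrable q (\<lambda>s. T (f s)) t"
    by (simp add: riemann_liouville_integrable_def set_integrable_def T.scaleR)
  have "(\<integral>s. T (?g s) \<partial>lborel) = T (\<integral>s. ?g s \<partial>lborel)"
    by (rule integral_bounded_linear[OF T.bounded_linear_axioms int])
  then show "riemann_liouville q (\<lambda>s. T (f s)) t = T (riemann_liouville q f t)"
    by (simp add: riemann_liouville_def set_lebesgue_integral_def T.scaleR)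
qed

lemma riemann_liouville_const:
  assumes "q > 0" "t \<ge> 0"
  shows "riemann_liouville q (\<lambda>_. b::real) t = b / Gamma (1 + q) * t powr q"
proof (cases "t = 0")
  case False
  have "(LBINT s:{0<..<t}. (t - s) powr (q - 1) * b) = b * (LBINT s:{0<..<t}. (t - s) powr (q - 1) * s powr (- 0))"
    by (subst set_integral_mult_right [symmetric], rule set_lebesgue_integral_cong) auto
  then have "riemann_liouville q (\<lambda>_. b) t = b * riemann_liouville q (\<lambda>s. s powr (- 0)) t"
    by (simp add: riemann_liouville_def)
  then show ?thesis using riemann_liouville_powr(2)[OF assms(1), of 0 t] assms False by simp
qed (use assms in simp)

lemma riemann_liouville_mono:
  fixes f g :: "real \<Rightarrow> real"
  assumes "q > 0" "riemann_liouville_integrable q f t" "riemann_liouville_integrable q g t"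
    and "\<And>s. s \<in> {0<..<t} \<Longrightarrow> f s \<le> g s"
  shows "riemann_liouville q f t \<le> riemann_liouville q g t"
  unfolding riemann_liouville_def using assms Gamma_real_pos[of q]
  by (auto simp: riemann_liouville_integrable_def intro!: divide_right_mono set_integral_mono mult_left_mono)

lemma riemann_liouville_norm_le:
  fixes f :: "real \<Rightarrow> 'a::euclidean_space"
  assumes "q > 0" "riemann_liouville_integrable q f t" "riemann_liouville_integrable q g t"
    and "\<And>s. s \<in> {0<..<t} \<Longrightarrow> norm (f s) \<le> g s"
  shows "norm (riemann_liouville q f t) \<le> riemann_liouville q g t"
proof -
  have int: "set_integrable lborel {0<..<t} (\<lambda>s. (t - s) powr (q - 1) *\<^sub>R f s)"
    using assms(2) by (simp add: riemann_liouville_integrable_def)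
  have "norm (LBINT s:{0<..<t}. (t - s) powr (q - 1) *\<^sub>R f s)
      \<le> (LBINT s:{0<..<t}. norm ((t - s) powr (q - 1) *\<^sub>R f s))"
    by (rule set_integral_norm_bound[OF int])
  also have "\<dots> \<le> (LBINT s:{0<..<t}. (t - s) powr (q - 1) *\<^sub>R g s)"
    using assms by (intro set_integral_mono set_integrable_norm int)
      (auto simp: riemann_liouville_integrable_def intro!: mult_left_mono)
  finally show ?thesis
    using Gamma_real_pos[OF assms(1)] by (simp add: riemann_liouville_def divide_right_mono)
qed

section \<open>Exponential bounds and continuity\<close>

text \<open>The substitution u = c (t - s) produces c^(-q) e^(c t) times a truncated Gamma integral,
  which is at most \<open>Gamma q\<close>.\<close>

lemma riemann_liouville_exp_le:
  assumes "q > 0" "c > 0" "t \<ge> 0"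
  shows "riemann_liouville q (\<lambda>s. exp (c * s)) t \<le> c powr (- q) * exp (c * t)"
proof -
  let ?f = "\<lambda>s. indicator {0<..<t} s *\<^sub>R ((t - s) powr (q - 1) * exp (c * s))"
  let ?g = "\<lambda>u. u powr (q - 1) / exp u"
  have body: "?f (t + (- 1 / c) * u) = (c powr (1 - q) * exp (c * t)) * (indicator {0<..<c * t} u * ?g u)" for u
  proof -
    have "t + (- 1 / c) * u \<in> {0<..<t} \<longleftrightarrow> u \<in> {0<..<c * t}"
      using assms(2) by (auto simp: field_simps)
    moreover have "?thesis" if "u \<in> {0<..<c * t}" "t + (- 1 / c) * u \<in> {0<..<t}"
    proof -
      have "(t - (t + (- 1 / c) * u)) powr (q - 1) = u powr (q - 1) * c powr (1 - q)"
        using that assms by (simp add: powr_divide powr_diff field_simps)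
      moreover have "exp (c * (t + (- 1 / c) * u)) = exp (c * t) / exp u"
        using assms by (simp add: distrib_left right_diff_distrib exp_diff)
      ultimately show ?thesis using that by (simp add: indicator_def)
    qed
    ultimately show ?thesis by (auto simp: indicator_def)
  qed
  have "(\<integral>s. ?f s \<partial>lborel) = \<bar>- 1 / c\<bar> *\<^sub>R (\<integral>u. ?f (t + (- 1 / c) * u) \<partial>lborel)"
    by (rule lborel_integral_real_affine) (use assms in auto)
  also have "\<dots> = \<bar>- 1 / c\<bar> *\<^sub>R (\<integral>u. (c powr (1 - q) * exp (c * t)) * (indicator {0<..<c * t} u * ?g u) \<partial>lborel)"
    unfolding body ..
  also have "(\<integral>u. (c powr (1 - q) * exp (c * t)) * (indicator {0<..<c * t} u * ?g u) \<partial>lborel)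
     = (c powr (1 - q) * exp (c * t)) * (LBINT u:{0<..<c * t}. ?g u)"
    by (subst integral_mult_right_zero) (simp add: set_lebesgue_integral_def)
  also have "\<bar>- 1 / c\<bar> *\<^sub>R \<dots> = c powr (- q) * exp (c * t) * (LBINT u:{0<..<c * t}. ?g u)"
    using assms by (simp add: powr_diff powr_minus_divide)
  finally have eq: "(\<integral>s. ?f s \<partial>lborel) = c powr (- q) * exp (c * t) * (LBINT u:{0<..<c * t}. ?g u)" .
  have le: "(LBINT u:{0<..<c * t}. ?g u) \<le> Gamma q"
  proof -
    have G: "(?g has_integral Gamma q) {0..}" by (rule Gamma_integral_real[OF assms(1)])
    \<comment> \<open>The Gamma integral is given as a gauge integral; nonnegativity turns it into a
      Lebesgue integral, and Borel measurability allows passing to \<open>lborel\<close>.\<close>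
    have abs: "set_integrable lebesgue {0..} ?g"
      using G by (intro nonnegative_absolutely_integrable_1) (auto simp: integrable_on_def)
    then have "set_integrable lborel {0..} ?g"
      unfolding set_integrable_def by (subst (asm) integrable_completion) auto
    then have I: "set_integrable lborel {0<..<c * t} ?g"
      by (rule set_integrable_subset) auto
    have "(LBINT u:{0<..<c * t}. ?g u) = integral {0<..<c * t} ?g"
      by (rule set_borel_integral_eq_integral(2)[OF I])
    also have "\<dots> \<le> integral {0..} ?g"
      using set_borel_integral_eq_integral(1)[OF I] G
      by (intro integral_subset_le) (auto simp: integrable_on_def)
    also have "\<dots> = Gamma q" using G by (rule integral_unique)
    finally show ?thesis .
  qed
  have "(LBINT s:{0<..<t}. (t - s) powr (q - 1) * exp (c * s)) \<le> c powr (- q) * exp (c * t) * Gamma q"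
    using eq mult_left_mono[OF le, of "c powr (- q) * exp (c * t)"] by (simp add: set_lebesgue_integral_def)
  then show ?thesis
    using Gamma_real_pos[OF assms(1)] by (simp add: riemann_liouville_def field_simps)
qed

text \<open>In the weighted supremum norm with weight e^(-c t), the operator has norm at most
  c^(-q). A large \<open>c\<close> thus makes it small on the whole half-line; uniqueness and
  existence both rest on this.\<close>

lemma riemann_liouville_norm_le_exp:
  fixes \<phi> :: "real \<Rightarrow> 'a::euclidean_space"
  assumes "q > 0" "c > 0" "t \<ge> 0" "D \<ge> 0" "continuous_on {0..t} \<phi>"
    and "\<And>s. s \<in> {0<..<t} \<Longrightarrow> norm (\<phi> s) \<le> D * exp (c * s)"
  shows "norm (riemann_liouville q \<phi> t) \<le> D * c powr (- q) * exp (c * t)"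
proof -
  have e: "riemann_liouville_integrable q (\<lambda>s. exp (c * s)) t"
    by (intro riemann_liouville_integrable_continuous continuous_intros assms)
  have "linear ((*) D)" by (rule linear_times)
  note l = riemann_liouville_linear[OF e this]
  have "norm (riemann_liouville q \<phi> t) \<le> riemann_liouville q (\<lambda>s. D * exp (c * s)) t"
    by (intro riemann_liouville_norm_le riemann_liouville_integrable_continuous assms l)
  also have "\<dots> \<le> D * (c powr (- q) * exp (c * t))"
    using riemann_liouville_exp_le[OF assms(1-3)] l assms(4) by (simp add: mult_left_mono)
  finally show ?thesis by simp
qed

text \<open>Scaling s = t r moves the dependence on t from the kernel and the domain into the
  argument of \<open>\<phi>\<close>. Dominated convergence over r in (0,1) applies, with
  \<open>B\<close> times the kernel as majorant.\<close>

lemma continuous_on_riemann_liouville: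
  fixes \<phi> :: "real \<Rightarrow> 'a::euclidean_space"
  assumes "q > 0" "continuous_on {0..} \<phi>" "\<And>s. s \<ge> 0 \<Longrightarrow> norm (\<phi> s) \<le> B"
  shows "continuous_on {0..} (riemann_liouville q \<phi>)"
proof -
  let ?k = "\<lambda>r. indicat_real {0<..<1} r * (1 - r) powr (q - 1)"
  let ?\<psi> = "\<lambda>r. indicat_real {0..} r *\<^sub>R \<phi> r"
  have [measurable]: "?\<psi> \<in> borel_measurable borel"
    by (rule borel_measurable_continuous_on_indicator) (use assms in auto)
  define G where "G t = (\<integral>r. ?k r *\<^sub>R ?\<psi> (t * r) \<partial>lborel)" for t
  have B0: "B \<ge> 0" using assms(3)[of 0] norm_ge_zero[of "\<phi> 0"] by linarith
  have eq: "riemann_liouville q \<phi> t = (t powr q / Gamma q) *\<^sub>R G t" if "t \<ge> 0" for t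
  proof (cases "t = 0")
    case False
    let ?f = "\<lambda>s. indicat_real {0<..<t} s *\<^sub>R (t - s) powr (q - 1) *\<^sub>R \<phi> s"
    have t: "t > 0" using that False by simp
    have "(\<integral>s. ?f s \<partial>lborel) = \<bar>t\<bar> *\<^sub>R (\<integral>r. ?f (0 + t * r) \<partial>lborel)"
      by (rule lborel_integral_real_affine) (use False in auto)
    also have "(\<integral>r. ?f (0 + t * r) \<partial>lborel) = (\<integral>r. t powr (q - 1) *\<^sub>R (?k r *\<^sub>R ?\<psi> (t * r)) \<partial>lborel)"
    proof (rule Bochner_Integration.integral_cong[OF refl])
      fix r
      have "t - t * r = t * (1 - r)" by (simp add: algebra_simps)
      then have "(t - t * r) powr (q - 1) = t powr (q - 1) * (1 - r) powr (q - 1)" if "r < 1"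
        using t that by (simp add: powr_mult)
      then show "?f (0 + t * r) = t powr (q - 1) *\<^sub>R (?k r *\<^sub>R ?\<psi> (t * r))"
        using t by (auto simp: indicator_def zero_less_mult_iff)
    qed
    also have "\<dots> = t powr (q - 1) *\<^sub>R G t"
      unfolding G_def by (rule integral_scaleR_right)
    finally have "(\<integral>s. ?f s \<partial>lborel) = t powr q *\<^sub>R G t"
      using t by (simp add: powr_diff)
    then show ?thesis by (simp add: riemann_liouville_def set_lebesgue_integral_def)
  qed simp
  have kint: "integrable lborel (\<lambda>r. ?k r * B)"
    using riemann_liouville_kernel_integrable[OF assms(1), of 1 B]
    by (simp add: set_integrable_def mult.assoc)
  have "continuous_on {0..} G"
  proof (rule continuous_on_sequentiallyI)
    fix u :: "nat \<Rightarrow> real" and a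
    assume u: "\<forall>n. u n \<in> {0..}" "a \<in> {0..}" "u \<longlonglongrightarrow> a"
    show "(\<lambda>n. G (u n)) \<longlonglongrightarrow> G a"
      unfolding G_def
    proof (rule integral_dominated_convergence[where w = "\<lambda>r. ?k r * B"])
      show "AE r in lborel. (\<lambda>n. ?k r *\<^sub>R ?\<psi> (u n * r)) \<longlonglongrightarrow> ?k r *\<^sub>R ?\<psi> (a * r)"
      proof (rule AE_I2)
        fix r :: real
        show "(\<lambda>n. ?k r *\<^sub>R ?\<psi> (u n * r)) \<longlonglongrightarrow> ?k r *\<^sub>R ?\<psi> (a * r)"
        proof (cases "r \<in> {0<..<1}")
          case True
          have "(\<lambda>n. \<phi> (u n * r)) \<longlonglongrightarrow> \<phi> (a * r)"
            by (rule continuous_on_tendsto_compose[OF assms(2)])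
               (use u True in \<open>auto intro!: tendsto_intros always_eventually\<close>)
          then show ?thesis using u True by (auto intro!: tendsto_intros)
        qed auto
      qed
      show "AE r in lborel. norm (?k r *\<^sub>R ?\<psi> (u n * r)) \<le> ?k r * B" for n
        using assms(3) B0 by (auto simp: indicator_def intro!: AE_I2 mult_left_mono)
      show "(\<lambda>r. ?k r *\<^sub>R ?\<psi> (a * r)) \<in> borel_measurable lborel" for a
        by measurable
      then show "(\<lambda>r. ?k r *\<^sub>R ?\<psi> (u n * r)) \<in> borel_measurable lborel" for n .
    qed (rule kint)
  qed
  moreover have "continuous_on {0..} (\<lambda>t::real. t powr q)"
    using assms(1) by (intro continuous_on_powr' continuous_intros) auto
  ultimately have "continuous_on {0..} (\<lambda>t. (t powr q / Gamma q) *\<^sub>R G t)"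
    using Gamma_real_pos[OF assms(1)]
    by (intro continuous_on_scaleR continuous_on_divide continuous_on_const) auto
  then show ?thesis
    by (rule continuous_on_eq) (use eq in auto)
qed

section \<open>Uniqueness and global existence\<close>

lemma caputo_solution_interval:
  assumes "caputo_solution_on q f J x" "t \<in> J"
  shows "t \<ge> 0" "{0..t} \<subseteq> J" "continuous_on {0..t} x"
proof -
  have J: "is_interval J" "0 \<in> J" "J \<subseteq> {0..}" "continuous_on J x"
    using assms(1) unfolding caputo_solution_on_def by blast+
  show "t \<ge> 0" using J(3) assms(2) by auto
  show "{0..t} \<subseteq> J" using mem_is_interval_1_I[OF J(1,2) assms(2)] by auto
  then show "continuous_on {0..t} x" using J(4) by (rule continuous_on_subset[rotated])
qed

text \<open>Replaces the gauge integral of the definition by the Lebesgue integral; both agree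
  because f(x(s)) is continuous on the compact interval from \<open>0\<close> to
  \<open>t\<close>.\<close>

lemma caputo_solution_on_iff:
  assumes "q > 0" "continuous_on UNIV f"
  shows "caputo_solution_on q f J x \<longleftrightarrow>
    is_interval J \<and> 0 \<in> J \<and> J \<subseteq> {0..} \<and> continuous_on J x \<and>
    (\<forall>t\<in>J. x t = x 0 + riemann_liouville q (\<lambda>s. f (x s)) t)"
proof -
  have "riemann_liouville q (\<lambda>s. f (x s)) t
      = (1 / Gamma q) *\<^sub>R integral {0..t} (\<lambda>s. (t - s) powr (q - 1) *\<^sub>R f (x s))"
    if "is_interval J" "0 \<in> J" "continuous_on J x" "t \<in> J" for t
  proof -
    have "{0..t} \<subseteq> J" using mem_is_interval_1_I[OF that(1,2,4)] by auto
    then have "continuous_on {0..t} (\<lambda>s. f (x s))"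
      using continuous_on_subset[OF that(3)] by (intro continuous_on_compose2[OF assms(2)]) auto
    then show ?thesis
      by (intro riemann_liouville_eq_integral riemann_liouville_integrable_continuous assms)
  qed
  then show ?thesis unfolding caputo_solution_on_def by (intro conj_cong ball_cong refl) simp
qed

text \<open>At a maximum point s of the weighted distance d, the Lipschitz bound and the exponential
  estimate give d(s) \<le> L c^(-q) d(s) with L c^(-q) < 1/2, so d vanishes. This replaces a
  fractional Gronwall inequality.\<close>

lemma caputo_solution_unique:
  fixes f :: "'a::euclidean_space \<Rightarrow> 'a"
  assumes q: "q > 0" and f: "continuous_on UNIV f"
    and lip: "\<And>R. \<exists>L. \<forall>u v. norm u \<le> R \<longrightarrow> norm v \<le> R \<longrightarrow> norm (f u - f v) \<le> L * norm (u - v)"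
    and x: "caputo_solution_on q f J x" and y: "caputo_solution_on q f J y"
    and "x 0 = y 0" "t \<in> J"
  shows "x t = y t"
proof -
  note X = caputo_solution_interval[OF x \<open>t \<in> J\<close>] and Y = caputo_solution_interval[OF y \<open>t \<in> J\<close>]
  have "bounded (x ` {0..t} \<union> y ` {0..t})"
    by (intro bounded_Un[THEN iffD2] conjI compact_imp_bounded compact_continuous_image X Y) auto
  then obtain R where R: "\<And>s. s \<in> {0..t} \<Longrightarrow> norm (x s) \<le> R \<and> norm (y s) \<le> R"
    unfolding bounded_iff by blast
  obtain L' where L': "\<And>u v. norm u \<le> R \<Longrightarrow> norm v \<le> R \<Longrightarrow> norm (f u - f v) \<le> L' * norm (u - v)"
    using lip by blast
  define L where "L = max L' 0"
  have L: "norm (f u - f v) \<le> L * norm (u - v)" if "norm u \<le> R" "norm v \<le> R" for u v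
    using L'[OF that] mult_right_mono[of L' L "norm (u - v)"] by (simp add: L_def)
  have L0: "L \<ge> 0" by (simp add: L_def)
  \<comment> \<open>Chosen so that c^q = 2 L + 1; the summand 1 keeps \<open>c\<close> positive when
    \<open>L\<close> is \<open>0\<close>.\<close>
  define c where "c = (2 * L + 1) powr (1 / q)"
  have c: "c > 0" "c powr (- q) = 1 / (2 * L + 1)"
    using L0 q by (simp_all add: c_def powr_powr powr_minus_divide)
  define d where "d s = exp (- c * s) * norm (x s - y s)" for s
  have "continuous_on {0..t} d"
    unfolding d_def by (intro continuous_intros X Y)
  then obtain s where s: "s \<in> {0..t}" "\<And>r. r \<in> {0..t} \<Longrightarrow> d r \<le> d s"
    using continuous_attains_sup[of "{0..t}" d] X(1) by (auto simp del: atLeastAtMost_iff)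
  have "s \<in> J" using s X by auto
  have cont: "continuous_on {0..s} (\<lambda>r. f (z r))" if "caputo_solution_on q f J z" for z
    using caputo_solution_interval(3)[OF that \<open>s \<in> J\<close>] by (intro continuous_on_compose2[OF f]) auto
  have "x s - y s = riemann_liouville q (\<lambda>s. f (x s)) s - riemann_liouville q (\<lambda>s. f (y s)) s"
  proof -
    have "x s = x 0 + riemann_liouville q (\<lambda>s. f (x s)) s" "y s = y 0 + riemann_liouville q (\<lambda>s. f (y s)) s"
      using x y \<open>s \<in> J\<close> unfolding caputo_solution_on_iff[OF q f] by blast+
    then show ?thesis using \<open>x 0 = y 0\<close> by (metis add_diff_cancel_left)
  qed
  also have "\<dots> = riemann_liouville q (\<lambda>s. f (x s) - f (y s)) s"
    by (intro riemann_liouville_integrable_diff(2)[symmetric] riemann_liouville_integrable_continuous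
        q cont x y)
  also have "norm \<dots> \<le> (L * d s) * c powr (- q) * exp (c * s)"
  proof (rule riemann_liouville_norm_le_exp[OF q c(1)])
    fix r assume r: "r \<in> {0<..<s}"
    then have rt: "r \<in> {0..t}" using s by auto
    have "norm (x r - y r) = d r * exp (c * r)"
      by (simp add: d_def exp_minus)
    also have "\<dots> \<le> d s * exp (c * r)" using s(2)[OF rt] by simp
    finally have "L * norm (x r - y r) \<le> L * (d s * exp (c * r))"
      using L0 by (rule mult_left_mono)
    then show "norm (f (x r) - f (y r)) \<le> L * d s * exp (c * r)"
      using L[of "x r" "y r"] R[OF rt] by simp
  qed (use s L0 in \<open>auto simp: d_def intro!: continuous_intros cont x y\<close>)
  finally have "norm (x s - y s) \<le> (L * d s) * c powr (- q) * exp (c * s)" .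
  then have "exp (- c * s) * norm (x s - y s) \<le> exp (- c * s) * ((L * d s) * c powr (- q) * exp (c * s))"
    by (rule mult_left_mono) simp
  then have "d s \<le> L * d s / (2 * L + 1)"
    by (simp add: d_def c(2) exp_minus field_simps)
  then have "d s * (2 * L + 1) \<le> L * d s" using L0 by (simp add: field_simps)
  moreover have "d s \<ge> 0" by (simp add: d_def)
  ultimately have "d s \<le> 0"
    using mult_nonneg_nonneg[OF L0 \<open>d s \<ge> 0\<close>] by (simp add: algebra_simps)
  then have "d t \<le> 0" using s(2)[of t] X(1) by simp
  then show ?thesis by (simp add: d_def mult_le_0_iff)
qed

text \<open>Banach's fixed point theorem on bounded continuous functions, for the unknown multiplied
  by e^(-c t). The weight makes the Picard operator a contraction with factor 1/2 on all of the
  half-line at once, so no continuation argument is needed.\<close>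

lemma caputo_solution_exists:
  fixes f :: "'a::euclidean_space \<Rightarrow> 'a"
  assumes q: "q > 0" and lip: "\<And>u v. norm (f u - f v) \<le> L * norm (u - v)"
    and B: "\<And>u. norm (f u) \<le> B"
  obtains x where "caputo_solution_on q f {0..} x" "x 0 = x0"
proof -
  define L' where "L' = max L 0"
  have L: "norm (f u - f v) \<le> L' * norm (u - v)" for u v
    using lip[of u v] mult_right_mono[of L L' "norm (u - v)"] by (simp add: L'_def)
  have L0: "L' \<ge> 0" by (simp add: L'_def)
  have "L'-lipschitz_on UNIV f"
    using L L0 by (auto simp: lipschitz_on_def dist_norm)
  then have f: "continuous_on UNIV f" by (rule lipschitz_on_continuous_on)
  have B0: "B \<ge> 0" using B[of 0] norm_ge_zero[of "f 0"] by linarith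
  define c where "c = (2 * L' + 1) powr (1 / q)"
  have c: "c > 0" "c powr (- q) = 1 / (2 * L' + 1)"
    using L0 q by (simp_all add: c_def powr_powr powr_minus_divide)
  have cq: "c powr (- q) \<le> 1" "L' * c powr (- q) \<le> 1 / 2"
    using L0 by (simp_all add: c(2) field_simps)
  \<comment> \<open>Here \<open>z\<close> is the weighted unknown e^(-c s) x(s), so
    \<open>\<psi> z\<close> is the forcing f(x(s)).\<close>
  define \<psi> where "\<psi> z s = f (exp (c * s) *\<^sub>R apply_bcontfun z s)" for z :: "real \<Rightarrow>\<^sub>C 'a" and s
  have \<psi>: "continuous_on S (\<psi> z)" for z S
    unfolding \<psi>_def by (intro continuous_on_compose2[OF f] continuous_intros) auto
  have int: "riemann_liouville_integrable q (\<psi> z) t" for z t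
    by (intro riemann_liouville_integrable_continuous q \<psi>)
  define F where "F z t = exp (- c * max 0 t) *\<^sub>R (x0 + riemann_liouville q (\<psi> z) (max 0 t))" for z t
  have Fb: "F z \<in> bcontfun" for z
  proof (rule bcontfun_normI)
    have "continuous_on {0..} (riemann_liouville q (\<psi> z))"
      by (rule continuous_on_riemann_liouville[OF q \<psi>, of _ B]) (simp add: \<psi>_def B)
    then have "continuous_on UNIV (\<lambda>t. riemann_liouville q (\<psi> z) (max 0 t))"
      by (rule continuous_on_compose2) (auto intro!: continuous_intros)
    then show "continuous_on UNIV (F z)"
      unfolding F_def by (intro continuous_intros)
    fix t :: real
    have "norm (riemann_liouville q (\<psi> z) (max 0 t)) \<le> B * c powr (- q) * exp (c * max 0 t)"
    proof (rule riemann_liouville_norm_le_exp[OF q c(1) _ B0 \<psi>])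
      fix s assume "s \<in> {0<..<max 0 t}"
      then have "1 \<le> exp (c * s)" using c(1) by simp
      then show "norm (\<psi> z s) \<le> B * exp (c * s)"
        using B[of "exp (c * s) *\<^sub>R apply_bcontfun z s"] mult_left_mono[of 1 "exp (c * s)" B] B0
        by (simp add: \<psi>_def)
    qed simp
    also have "\<dots> \<le> B * exp (c * max 0 t)"
      using cq(1) B0 by (intro mult_right_mono mult_left_le) auto
    finally have 1: "norm (riemann_liouville q (\<psi> z) (max 0 t)) \<le> B * exp (c * max 0 t)" .
    have "norm (F z t) = exp (- c * max 0 t) * norm (x0 + riemann_liouville q (\<psi> z) (max 0 t))"
      by (simp add: F_def)
    also have "\<dots> \<le> exp (- c * max 0 t) * (norm x0 + B * exp (c * max 0 t))"
      using 1 by (intro mult_left_mono norm_triangle_le add_left_mono) auto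
    also have "\<dots> = exp (- c * max 0 t) * norm x0 + B"
      by (simp add: algebra_simps exp_minus)
    also have "\<dots> \<le> norm x0 + B"
      using c(1) by (simp add: mult_left_le_one_le)
    finally show "norm (F z t) \<le> norm x0 + B" .
  qed
  define \<Phi> where "\<Phi> z = Bcontfun (F z)" for z
  have \<Phi>: "apply_bcontfun (\<Phi> z) = F z" for z
    unfolding \<Phi>_def using Fb by (rule Bcontfun_inverse)
  have "dist (\<Phi> z) (\<Phi> z') \<le> 1 / 2 * dist z z'" for z z'
  proof (rule dist_bound)
    fix t :: real
    define \<tau> where "\<tau> = max 0 t"
    have "F z t - F z' t = exp (- c * \<tau>) *\<^sub>R (riemann_liouville q (\<psi> z) \<tau> - riemann_liouville q (\<psi> z') \<tau>)"
      by (simp add: F_def \<tau>_def algebra_simps)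
    also have "riemann_liouville q (\<psi> z) \<tau> - riemann_liouville q (\<psi> z') \<tau>
        = riemann_liouville q (\<lambda>s. \<psi> z s - \<psi> z' s) \<tau>"
      by (intro riemann_liouville_integrable_diff(2)[symmetric] int)
    finally have eq: "norm (F z t - F z' t) = exp (- c * \<tau>) * norm (riemann_liouville q (\<lambda>s. \<psi> z s - \<psi> z' s) \<tau>)"
      by simp
    have le: "norm (riemann_liouville q (\<lambda>s. \<psi> z s - \<psi> z' s) \<tau>)
        \<le> (L' * dist z z') * c powr (- q) * exp (c * \<tau>)"
    proof (rule riemann_liouville_norm_le_exp[OF q c(1)])
      fix s :: real
      have 1: "norm (\<psi> z s - \<psi> z' s) \<le> L' * norm (exp (c * s) *\<^sub>R z s - exp (c * s) *\<^sub>R z' s)"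
        unfolding \<psi>_def by (rule L)
      have "norm (exp (c * s) *\<^sub>R z s - exp (c * s) *\<^sub>R z' s) = exp (c * s) * dist (z s) (z' s)"
        by (simp add: dist_norm flip: scaleR_diff_right)
      also have "\<dots> \<le> exp (c * s) * dist z z'"
        by (simp add: dist_bounded)
      finally have "L' * norm (exp (c * s) *\<^sub>R z s - exp (c * s) *\<^sub>R z' s) \<le> L' * (exp (c * s) * dist z z')"
        using L0 by (rule mult_left_mono)
      also have "\<dots> = L' * dist z z' * exp (c * s)" by simp
      finally show "norm (\<psi> z s - \<psi> z' s) \<le> L' * dist z z' * exp (c * s)"
        using 1 by (rule order_trans[rotated])
    qed (auto simp: \<tau>_def L0 intro!: continuous_intros \<psi>)
    have "norm (F z t - F z' t) \<le> exp (- c * \<tau>) * ((L' * dist z z') * c powr (- q) * exp (c * \<tau>))"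
      unfolding eq using le by (rule mult_left_mono) simp
    also have "\<dots> = (L' * c powr (- q)) * dist z z'"
      by (simp add: exp_minus)
    also have "\<dots> \<le> 1 / 2 * dist z z'"
      using cq(2) by (rule mult_right_mono) simp
    finally show "dist (apply_bcontfun (\<Phi> z) t) (apply_bcontfun (\<Phi> z') t) \<le> 1 / 2 * dist z z'"
      by (simp add: \<Phi> dist_norm)
  qed
  then obtain z where z: "\<Phi> z = z"
    using banach_fix_type[of "1/2" \<Phi>] by auto
  define x where "x t = exp (c * t) *\<^sub>R z t" for t
  have xt: "x t = x0 + riemann_liouville q (\<lambda>s. f (x s)) t" if "t \<ge> 0" for t
  proof -
    have "z t = F z t" using \<Phi>[of z] z by simp
    then show ?thesis using that by (simp add: x_def F_def \<psi>_def [abs_def] exp_minus)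
  qed
  have "x 0 = x0" using xt[of 0] by simp
  moreover have "caputo_solution_on q f {0..} x"
    unfolding caputo_solution_on_iff[OF q f]
  proof (intro conjI ballI)
    show "continuous_on {0..} x" unfolding x_def by (intro continuous_intros) auto
    show "x t = x 0 + riemann_liouville q (\<lambda>s. f (x s)) t" if "t \<in> {0..}" for t
      using xt[of t] that \<open>x 0 = x0\<close> by simp
  qed (auto simp: is_interval_ci)
  ultimately show thesis by (rule that[rotated])
qed

section \<open>Invariant boxes\<close>

lemma caputo_solution_component:
  fixes f :: "real ^ 'n \<Rightarrow> real ^ 'n"
  assumes q: "q > 0" and f: "continuous_on UNIV f" and x: "caputo_solution_on q f {0..} x" and "t \<ge> 0"
  shows "x t $ i = x 0 $ i + riemann_liouville q (\<lambda>s. f (x s) $ i) t"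
proof -
  have "continuous_on {0..t} x"
    using caputo_solution_interval(3)[OF x] \<open>t \<ge> 0\<close> by simp
  then have "riemann_liouville_integrable q (\<lambda>s. f (x s)) t"
    by (intro riemann_liouville_integrable_continuous q continuous_on_compose2[OF f]) auto
  then have "riemann_liouville q (\<lambda>s. f (x s) $ i) t = riemann_liouville q (\<lambda>s. f (x s)) t $ i"
    by (rule riemann_liouville_linear(2)) (rule bounded_linear.linear[OF bounded_linear_vec_nth])
  moreover have "x t = x 0 + riemann_liouville q (\<lambda>s. f (x s)) t"
    using x \<open>t \<ge> 0\<close> unfolding caputo_solution_on_iff[OF q f] by blast
  ultimately show ?thesis by (metis vector_add_component)
qed

text \<open>
  Initial values are absorbed into the forcing term: a constant \<open>a\<close> is the Riemann--Liouville
  integral of \<open>a / \<Gamma>(1-q) s\<^sup>-\<^sup>q\<close>.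
\<close>

lemma caputo_solution_in_moving_box:
  fixes f :: "real ^ 'n \<Rightarrow> real ^ 'n"
  assumes q: "0 < q" "q < 1" and f: "continuous_on UNIV f" and x: "caputo_solution_on q f {0..} x"
    and V: "continuous_on {0<..} V" "\<And>t. t > 0 \<Longrightarrow> riemann_liouville_integrable q V t"
    and v: "continuous_on {0<..} v" "\<And>t. t > 0 \<Longrightarrow> v t = riemann_liouville q V t"
    and T: "T > 0" and init: "\<And>i t. 0 < t \<Longrightarrow> t \<le> T \<Longrightarrow> \<bar>x t $ i\<bar> \<le> v t"
    and inward: "\<And>i \<sigma> t. \<lbrakk>t \<ge> T; \<And>j. \<bar>x t $ j\<bar> \<le> v t; \<bar>\<sigma>\<bar> = 1; \<sigma> * x t $ i = v t\<rbrakk>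
      \<Longrightarrow> \<sigma> * f (x t) $ i + \<sigma> * x 0 $ i / Gamma (1 - q) * t powr (- q) < V t"
    and "t > 0"
  shows "\<bar>x t $ i\<bar> \<le> v t"
proof -
  have G: "Gamma (1 - q) > 0" using q by simp
  \<comment> \<open>One family member for each face of the box: \<open>w\<close> measures the excess
    of \<open>\<sigma> * x s $ i\<close> over \<open>v s\<close>, and \<open>H\<close> is the
    density of which it is the Riemann-Liouville integral.\<close>
  define I :: "('n \<times> real) set" where "I = UNIV \<times> {1, - 1}"
  define H where "H = (\<lambda>(i, \<sigma>) s. \<sigma> * f (x s) $ i + \<sigma> * x 0 $ i / Gamma (1 - q) * s powr (- q) - V s)"
  define w where "w = (\<lambda>(i, \<sigma>) s. \<sigma> * x s $ i - v s)"
  have xc: "continuous_on {0..} x"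
    using x unfolding caputo_solution_on_def by blast
  have fc: "continuous_on S (\<lambda>s. f (x s))" if "S \<subseteq> {0..}" for S
    using continuous_on_subset[OF xc that] by (intro continuous_on_compose2[OF f]) auto
  have H_eq: "riemann_liouville_integrable q (H (i, \<sigma>)) s \<and> w (i, \<sigma>) s = riemann_liouville q (H (i, \<sigma>)) s"
    if s: "s > 0" for i \<sigma> s
  proof -
    let ?c = "\<sigma> * x 0 $ i / Gamma (1 - q)"
    have "continuous_on {0..s} (\<lambda>s. f (x s) $ i)"
      by (intro continuous_intros fc) auto
    then have 0: "riemann_liouville_integrable q (\<lambda>s. f (x s) $ i) s"
      by (rule riemann_liouville_integrable_continuous[OF q(1)])
    note 1 = riemann_liouville_linear[OF 0 linear_times[of \<sigma>]]
    note p = riemann_liouville_powr[OF q(1) q(2) s]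
    note 2 = riemann_liouville_linear[OF p(1) linear_times[of ?c]]
    note 3 = riemann_liouville_integrable_add[OF 1(1) 2(1)]
    note 4 = riemann_liouville_integrable_diff[OF 3(1) V(2)[OF s]]
    have "riemann_liouville q (\<lambda>s. ?c * s powr (- q)) s = \<sigma> * x 0 $ i"
      using 2(2) p(2) s G by simp
    then have "riemann_liouville q (H (i, \<sigma>)) s = \<sigma> * x s $ i - v s"
      using 4(2) 3(2) 1(2) v(2)[OF s] caputo_solution_component[OF q(1) f x, of s i] s
      by (simp add: H_def algebra_simps)
    then show ?thesis using 4(1) by (simp add: H_def w_def)
  qed
  have "w (i, \<sigma>) t \<le> 0" if "(i, \<sigma>) \<in> I" for \<sigma>
  proof (rule riemann_liouville_family_nonpos[OF q _ T, where H = H and w = w and I = I])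
    show "finite I" by (simp add: I_def)
    fix k assume k: "k \<in> I"
    obtain i \<sigma> where [simp]: "k = (i, \<sigma>)" by (cases k)
    have \<sigma>: "\<bar>\<sigma>\<bar> = 1" using k by (auto simp: I_def)
    show "continuous_on {0<..} (H k)"
      unfolding H_def using G by (auto intro!: continuous_intros fc V)
    show "continuous_on {0<..} (w k)"
      unfolding w_def by (auto intro!: continuous_intros v continuous_on_subset[OF xc])
    show "riemann_liouville_integrable q (H k) s" "w k s = riemann_liouville q (H k) s" if "s > 0" for s
      using H_eq[OF that] by auto
    show "w k s \<le> 0" if "s \<in> {0<..T}" for s
      using init[of s i] \<sigma> that by (auto simp: w_def abs_if split: if_splits)
    show "H k s < 0" if "s \<ge> T" "w k s = 0" and le: "\<And>j. j \<in> I \<Longrightarrow> w j s \<le> 0" for s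
    proof -
      have "\<bar>x s $ j\<bar> \<le> v s" for j
        using le[of "(j, 1)"] le[of "(j, - 1)"] by (auto simp: I_def w_def)
      then show ?thesis
        using inward[OF \<open>s \<ge> T\<close> _ \<sigma>, of i] that(2) by (auto simp: w_def H_def)
    qed
  qed (use that \<open>t > 0\<close> in auto)
  from this[of 1] this[of "- 1"] show ?thesis by (auto simp: I_def w_def)
qed

text \<open>The moving-box lemma with constant radius, \<open>M\<close> being the integral of M /
  \<Gamma>(1-q) s^(-q). The strict inequality at time \<open>0\<close> persists on a short interval
  by continuity and provides the initial stretch.\<close>

lemma caputo_solution_in_box:
  fixes f :: "real ^ 'n \<Rightarrow> real ^ 'n"
  assumes q: "0 < q" "q < 1" and f: "continuous_on UNIV f" and x: "caputo_solution_on q f {0..} x"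
    and init: "\<And>i. \<bar>x 0 $ i\<bar> < M"
    and inward: "\<And>i \<sigma> u. \<lbrakk>\<And>j. \<bar>u $ j\<bar> \<le> M; \<bar>\<sigma>\<bar> = 1; \<sigma> * u $ i = M\<rbrakk> \<Longrightarrow> \<sigma> * f u $ i < 0"
    and "t \<ge> 0"
  shows "\<bar>x t $ i\<bar> \<le> M"
proof (cases "t = 0")
  case False
  have G: "Gamma (1 - q) > 0" using q by simp
  define V where "V s = M / Gamma (1 - q) * s powr (- q)" for s
  have V: "riemann_liouville_integrable q V s \<and> M = riemann_liouville q V s" if "s > 0" for s
  proof -
    note p = riemann_liouville_powr[OF q(1) q(2) that]
    note l = riemann_liouville_linear[OF p(1) linear_times[of "M / Gamma (1 - q)"]]
    show ?thesis using l p(2) that G by (simp add: V_def [abs_def])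
  qed
  have xc: "continuous_on {0..} x"
    using x unfolding caputo_solution_on_def by blast
  have "\<forall>\<^sub>F s in at_right 0. \<bar>x s $ i\<bar> < M" for i
  proof (rule order_tendstoD(2)[OF _ init])
    have "(x \<longlongrightarrow> x 0) (at 0 within {0..})"
      using xc by (simp add: continuous_on_def)
    then have "(x \<longlongrightarrow> x 0) (at_right 0)"
      by (rule tendsto_within_subset) auto
    then show "((\<lambda>s. \<bar>x s $ i\<bar>) \<longlongrightarrow> \<bar>x 0 $ i\<bar>) (at_right 0)"
      by (intro tendsto_intros)
  qed
  then have "\<forall>\<^sub>F s in at_right 0. \<forall>i. \<bar>x s $ i\<bar> < M"
    by (simp add: eventually_all_finite)
  then obtain b where b: "b > 0" "\<And>s i. 0 < s \<Longrightarrow> s < b \<Longrightarrow> \<bar>x s $ i\<bar> < M"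
    unfolding eventually_at_right_field by blast
  show ?thesis
  proof (rule caputo_solution_in_moving_box[OF q f x, where V = V and v = "\<lambda>_. M" and T = "b / 2"])
    show "continuous_on {0<..} V" unfolding V_def by (intro continuous_intros) auto
    show "\<bar>x s $ i\<bar> \<le> M" if "0 < s" "s \<le> b / 2" for s i
      using b(2)[of s i] b(1) that by simp
    show "\<sigma> * f (x s) $ i + \<sigma> * x 0 $ i / Gamma (1 - q) * s powr (- q) < V s"
      if "b / 2 \<le> s" "\<And>j. \<bar>x s $ j\<bar> \<le> M" "\<bar>\<sigma>\<bar> = 1" "\<sigma> * x s $ i = M" for i \<sigma> s
    proof -
      \<comment> \<open>Hence the forcing term from the initial value is at most \<open>V s\<close>,
        and strictness comes from the inward field.\<close>
      have "\<sigma> * x 0 $ i \<le> M"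
        using init[of i] that(3) by (auto simp: abs_if split: if_splits)
      then have "\<sigma> * x 0 $ i / Gamma (1 - q) * s powr (- q) \<le> V s"
        unfolding V_def using G by (intro mult_right_mono divide_right_mono) auto
      then show ?thesis using inward[OF that(2-4)] by simp
    qed
  qed (use V b False \<open>t \<ge> 0\<close> in auto)
qed (use init[of i] in simp)

text \<open>The box radius is v(t) = (C + 1) t^(-\<beta>) with \<beta> = q (1 - q), the integral of
  the positive density V = A s^(-p) with p = q + \<beta>. On a face, the damping - \<gamma> v(t)
  outweighs the initial-value term of order t^(-q), because \<beta> < q.\<close>

lemma caputo_solution_tendsto_0:
  fixes f :: "real ^ 'n \<Rightarrow> real ^ 'n"
  assumes q: "0 < q" "q < 1" and f: "continuous_on UNIV f" and x: "caputo_solution_on q f {0..} x"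
    and bound: "\<And>t i. t \<ge> 0 \<Longrightarrow> \<bar>x t $ i\<bar> \<le> M" and \<gamma>: "\<gamma> > 0"
    and inward: "\<And>t i \<sigma> r. \<lbrakk>t \<ge> 0; \<And>j. \<bar>x t $ j\<bar> \<le> r; \<bar>\<sigma>\<bar> = 1; \<sigma> * x t $ i = r\<rbrakk>
      \<Longrightarrow> \<sigma> * f (x t) $ i \<le> - \<gamma> * r"
  shows "((\<lambda>t. norm (x t)) \<longlongrightarrow> 0) at_top"
proof -
  have G: "Gamma (1 - q) > 0" using q by simp
  have M0: "M \<ge> 0" using bound[of 0 undefined] by simp
  \<comment> \<open>Two demands meet here: p < 1 for integrability, which holds as 1 - p = (1 -
    q)^2, and p - q < q for the decay comparison.\<close>
  define p where "p = q + q * (1 - q)"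
  have "1 - p = (1 - q) ^ 2" by (simp add: p_def power2_eq_square algebra_simps)
  moreover have "(1 - q) ^ 2 > 0" using q by simp
  ultimately have p: "p < 1" "q - p = - (q * (1 - q))"
    by (simp_all only: p_def)
  have Gp: "Gamma (1 - p) > 0" "Gamma (1 + q - p) > 0"
    using p q by (auto intro!: Gamma_real_pos)
  \<comment> \<open>The first entry keeps the solution inside the box up to time 1; the second lets
    the damping absorb the initial-value term afterwards. The extra 1 in \<open>v\<close> makes
    \<open>A\<close> and \<open>V\<close> positive even if \<open>M = 0\<close>, giving strict
    inequality.\<close>
  define C where "C = max M (M / (\<gamma> * Gamma (1 - q)))"
  have C: "C \<ge> M" "\<gamma> * C \<ge> M / Gamma (1 - q)" "C \<ge> 0"
    using \<gamma> G M0 by (auto simp: C_def max_def field_simps)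
  define A where "A = (C + 1) * Gamma (1 + q - p) / Gamma (1 - p)"
  have A: "A > 0" using C Gp by (simp add: A_def)
  define V where "V s = A * s powr (- p)" for s
  define v where "v s = (C + 1) * s powr (q - p)" for s
  have V: "riemann_liouville_integrable q V s \<and> v s = riemann_liouville q V s" if "s > 0" for s
  proof -
    note r = riemann_liouville_powr[OF q(1) p(1) that]
    note l = riemann_liouville_linear[OF r(1) linear_times[of A]]
    show ?thesis using l r(2) Gp by (simp add: V_def [abs_def] v_def A_def)
  qed
  have le: "\<bar>x t $ i\<bar> \<le> v t" if "t > 0" for t i
  proof (rule caputo_solution_in_moving_box[OF q f x, where V = V and v = v and T = 1])
    show "continuous_on {0<..} V" "continuous_on {0<..} v"
      unfolding V_def v_def by (auto intro!: continuous_intros)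
    show "\<bar>x s $ i\<bar> \<le> v s" if "0 < s" "s \<le> 1" for s i
    proof -
      have "1 \<le> s powr (q - p)"
        using powr_mono'[of "q - p" 0 s] that p q by simp
      then have "C + 1 \<le> v s"
        using C(3) mult_left_mono[of 1 "s powr (q - p)" "C + 1"] by (simp add: v_def)
      then show ?thesis using bound[of s i] C(1) that by simp
    qed
    show "\<sigma> * f (x s) $ i + \<sigma> * x 0 $ i / Gamma (1 - q) * s powr (- q) < V s"
      if "1 \<le> s" "\<And>j. \<bar>x s $ j\<bar> \<le> v s" "\<bar>\<sigma>\<bar> = 1" "\<sigma> * x s $ i = v s" for i \<sigma> s
    proof -
      have "\<sigma> * x 0 $ i \<le> M"
        using bound[of 0 i] that(3) by (auto simp: abs_if split: if_splits)
      then have "\<sigma> * x 0 $ i / Gamma (1 - q) * s powr (- q) \<le> M / Gamma (1 - q) * s powr (- q)"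
        using G by (intro mult_right_mono divide_right_mono) auto
      also have "\<dots> \<le> \<gamma> * C * s powr (- q)"
        using C(2) by (rule mult_right_mono) simp
      also have "\<dots> \<le> \<gamma> * C * s powr (q - p)"
        using \<gamma> C(3) q p(2) that(1) by (intro mult_left_mono powr_mono) (auto simp: algebra_simps)
      also have "\<dots> \<le> \<gamma> * v s"
        using \<gamma> unfolding v_def by (auto simp: algebra_simps)
      finally have "\<sigma> * x 0 $ i / Gamma (1 - q) * s powr (- q) \<le> \<gamma> * v s" .
      moreover have "V s > 0" using A that(1) by (simp add: V_def)
      moreover have "\<sigma> * f (x s) $ i \<le> - \<gamma> * v s"
        using inward[OF _ that(2-4)] that(1) by simp
      ultimately show ?thesis by simp
    qed
  qed (use V that in auto)
  have "((\<lambda>t. t powr (q - p)) \<longlongrightarrow> 0) at_top"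
    by (rule tendsto_neg_powr) (use p q in \<open>auto intro: filterlim_ident\<close>)
  then have vlim: "(v \<longlongrightarrow> 0) at_top"
    unfolding v_def by (auto intro: tendsto_mult_right_zero)
  have "((\<lambda>t. x t $ i) \<longlongrightarrow> 0) at_top" for i
    by (rule Lim_null_comparison[OF _ vlim]) (use le in \<open>auto simp: eventually_at_top_dense\<close>)
  then have "(x \<longlongrightarrow> 0) at_top"
    by (intro vec_tendstoI) simp
  then show ?thesis by (rule tendsto_norm_zero)
qed

section \<open>The controlled Lagrange system\<close>

lemma controlled_lagrange_component:
  "controlled_lagrange c1 c2 u $ 1 = u $ 2 * u $ 3 + c1 * u $ 1"
  "controlled_lagrange c1 c2 u $ 2 = u $ 1 * u $ 3 + c2 * u $ 2"
  "controlled_lagrange c1 c2 u $ 3 = u $ 1 * u $ 2 + c2 * u $ 3"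
  by (simp_all add: controlled_lagrange_def)

lemma equilibrium_controlled_lagrange: "equilibrium (controlled_lagrange c1 c2) 0"
  by (simp add: equilibrium_def vec_eq_iff forall_3 controlled_lagrange_component)

text \<open>Each product is split as u v - u' v' = u (v - v') + v' (u - u'), and the factor 3 comes
  from summing the components. Taking \<open>v = 0\<close> also bounds the field itself.\<close>

lemma controlled_lagrange_lipschitz:
  assumes "\<And>i. \<bar>u $ i\<bar> \<le> R" "\<And>i. \<bar>v $ i\<bar> \<le> R"
  shows "norm (controlled_lagrange c1 c2 u - controlled_lagrange c1 c2 v)
    \<le> 3 * (2 * R + \<bar>c1\<bar> + \<bar>c2\<bar>) * norm (u - v)"
proof -
  define d where "d = norm (u - v)"
  have d: "\<bar>u $ i - v $ i\<bar> \<le> d" for i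
    using component_le_norm_cart[of "u - v" i] by (simp add: d_def)
  have main: "\<bar>(u $ i * u $ j + c * u $ k) - (v $ i * v $ j + c * v $ k)\<bar> \<le> (2 * R + \<bar>c1\<bar> + \<bar>c2\<bar>) * d"
    if "c = c1 \<or> c = c2" for i j k c
  proof -
    have "(u $ i * u $ j + c * u $ k) - (v $ i * v $ j + c * v $ k)
        = u $ i * (u $ j - v $ j) + v $ j * (u $ i - v $ i) + c * (u $ k - v $ k)"
      by (simp add: algebra_simps)
    also have "\<bar>\<dots>\<bar> \<le> \<bar>u $ i\<bar> * \<bar>u $ j - v $ j\<bar> + \<bar>v $ j\<bar> * \<bar>u $ i - v $ i\<bar> + \<bar>c\<bar> * \<bar>u $ k - v $ k\<bar>"
      unfolding abs_mult [symmetric] by linarith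
    also have "\<dots> \<le> R * d + R * d + (\<bar>c1\<bar> + \<bar>c2\<bar>) * d"
      using that order_trans[OF abs_ge_zero assms(1)] by (intro add_mono mult_mono assms d) auto
    finally show ?thesis by (simp add: algebra_simps)
  qed
  have "norm (controlled_lagrange c1 c2 u - controlled_lagrange c1 c2 v)
    \<le> (\<Sum>i\<in>UNIV. \<bar>(controlled_lagrange c1 c2 u - controlled_lagrange c1 c2 v) $ i\<bar>)"
    by (rule norm_le_l1_cart)
  also have "\<dots> \<le> (\<Sum>i\<in>(UNIV :: 3 set). (2 * R + \<bar>c1\<bar> + \<bar>c2\<bar>) * d)"
  proof (rule sum_mono)
    fix i :: 3
    show "\<bar>(controlled_lagrange c1 c2 u - controlled_lagrange c1 c2 v) $ i\<bar> \<le> (2 * R + \<bar>c1\<bar> + \<bar>c2\<bar>) * d"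
      using exhaust_3[of i] main[of c1 2 3 1] main[of c2 1 3 2] main[of c2 1 2 3]
      by (auto simp: controlled_lagrange_component)
  qed
  finally show ?thesis by (simp add: d_def algebra_simps)
qed

lemma continuous_on_controlled_lagrange: "continuous_on S (controlled_lagrange c1 c2)"
proof -
  have "continuous_on S (\<lambda>u. u $ 2 * u $ 3 + c1 * u $ 1)"
    "continuous_on S (\<lambda>u. u $ 1 * u $ 3 + c2 * u $ 2)"
    "continuous_on S (\<lambda>u. u $ 1 * u $ 2 + c2 * u $ 3)" for S :: "(real ^ 3) set"
    by (intro continuous_intros)+
  then have "continuous_on S (\<lambda>u. controlled_lagrange c1 c2 u $ i)" for i
    using exhaust_3[of i] by (elim disjE) (simp_all only: controlled_lagrange_component)
  then have "continuous_on S (\<lambda>u. \<chi> i. controlled_lagrange c1 c2 u $ i)"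
    by (rule continuous_on_vec_lambda)
  then show ?thesis by simp
qed

lemma controlled_lagrange_solution_unique:
  assumes "q > 0" "caputo_solution_on q (controlled_lagrange c1 c2) J x"
    "caputo_solution_on q (controlled_lagrange c1 c2) J y" "x 0 = y 0" "t \<in> J"
  shows "x t = y t"
proof (rule caputo_solution_unique[OF assms(1) continuous_on_controlled_lagrange _ assms(2-5)])
  fix R :: real
  have "norm (controlled_lagrange c1 c2 u - controlled_lagrange c1 c2 v)
      \<le> 3 * (2 * R + \<bar>c1\<bar> + \<bar>c2\<bar>) * norm (u - v)" if "norm u \<le> R" "norm v \<le> R" for u v
    by (rule controlled_lagrange_lipschitz) (rule order_trans[OF component_le_norm_cart], fact that)+
  then show "\<exists>L. \<forall>u v. norm u \<le> R \<longrightarrow> norm v \<le> R \<longrightarrow>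
      norm (controlled_lagrange c1 c2 u - controlled_lagrange c1 c2 v) \<le> L * norm (u - v)"
    by blast
qed

text \<open>Of the two factors in the quadratic term, one is bounded by the fixed radius
  \<open>M\<close> and the other by the current radius \<open>r\<close>; the linear term contributes
  c r. For M + max c1 c2 < 0 the field therefore points inwards at a rate proportional to
  \<open>r\<close>, as the decay lemma demands.\<close>

lemma controlled_lagrange_inward:
  assumes "\<And>j. \<bar>u $ j\<bar> \<le> M" "\<And>j. \<bar>u $ j\<bar> \<le> r" "\<bar>\<sigma>\<bar> = 1" "\<sigma> * u $ i = r"
  shows "\<sigma> * controlled_lagrange c1 c2 u $ i \<le> (M + max c1 c2) * r"
proof -
  have r: "r \<ge> 0" using order_trans[OF abs_ge_zero assms(2)] .
  have main: "\<sigma> * (u $ j * u $ k + c * u $ i) \<le> (M + max c1 c2) * r" if "c \<le> max c1 c2" for j k c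
  proof -
    have "\<sigma> * (u $ j * u $ k) \<le> \<bar>\<sigma> * (u $ j * u $ k)\<bar>" by simp
    also have "\<dots> = \<bar>u $ j\<bar> * \<bar>u $ k\<bar>" using assms(3) by (simp add: abs_mult)
    also have "\<dots> \<le> M * r"
      using order_trans[OF abs_ge_zero assms(1)] by (intro mult_mono assms) auto
    finally have "\<sigma> * (u $ j * u $ k) \<le> M * r" .
    moreover have "c * r \<le> max c1 c2 * r" using that r by (rule mult_right_mono)
    moreover have "\<sigma> * (c * u $ i) = c * r" unfolding assms(4)[symmetric] by simp
    ultimately show ?thesis unfolding distrib_left distrib_right by linarith
  qed
  show ?thesis
    using exhaust_3[of i] main[of c1 2 3] main[of c2 1 3] main[of c2 1 2]
    by (auto simp: controlled_lagrange_component)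
qed

text \<open>Composing the field with the clamp onto the box makes it bounded and globally Lipschitz,
  so a global solution exists. The box is invariant for the truncated field, hence this solution
  never leaves the region where both fields agree.\<close>

lemma controlled_lagrange_global_solution:
  fixes x0 :: "real ^ 3"
  assumes q: "0 < q" "q < 1" and M: "M > 0" "M + max c1 c2 < 0" and x0: "\<And>i. \<bar>x0 $ i\<bar> < M"
  obtains y where "caputo_solution_on q (controlled_lagrange c1 c2) {0..} y" "y 0 = x0"
    "\<And>t i. t \<ge> 0 \<Longrightarrow> \<bar>y t $ i\<bar> \<le> M"
proof -
  let ?f = "controlled_lagrange c1 c2"
  let ?cl = "clamp (\<chi> i. - M) (\<chi> i. M) :: real ^ 3 \<Rightarrow> real ^ 3"
  define g where "g u = ?f (?cl u)" for u
  have box: "u \<in> cbox (\<chi> i. - M) (\<chi> i. M) \<longleftrightarrow> (\<forall>i. \<bar>u $ i\<bar> \<le> M)" for u :: "real ^ 3"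
    by (auto simp: mem_box_cart abs_le_iff minus_le_iff)
  have "?cl u \<in> cbox (\<chi> i. - M) (\<chi> i. M)" for u
    using M(1) by (intro clamp_in_interval) (auto simp: Basis_vec_def inner_axis)
  then have cl: "\<bar>?cl u $ i\<bar> \<le> M" for u i by (simp add: box)
  have cl_id: "?cl u = u" if "\<And>i. \<bar>u $ i\<bar> \<le> M" for u
    using that by (intro clamp_cancel_cbox) (simp add: box)
  define L where "L = 3 * (2 * M + \<bar>c1\<bar> + \<bar>c2\<bar>)"
  have L0: "L \<ge> 0" using M by (simp add: L_def)
  have lip: "norm (g u - g v) \<le> L * norm (u - v)" for u v
  proof -
    have "norm (g u - g v) \<le> L * norm (?cl u - ?cl v)"
      unfolding g_def L_def by (intro controlled_lagrange_lipschitz cl)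
    also have "\<dots> \<le> L * norm (u - v)"
      using dist_clamps_le_dist_args[of "\<chi> i. - M" "\<chi> i. M" u v] L0
      by (intro mult_left_mono) (auto simp: dist_norm)
    finally show ?thesis .
  qed
  have bound: "norm (g u) \<le> L * norm (\<chi> i. M :: real ^ 3)" for u
  proof -
    have "norm (g u) = norm (?f (?cl u) - ?f 0)"
      using equilibrium_controlled_lagrange[of c1 c2] by (simp add: g_def equilibrium_def)
    also have "\<dots> \<le> L * norm (?cl u - 0)"
      unfolding L_def using M by (intro controlled_lagrange_lipschitz cl) auto
    also have "\<dots> \<le> L * norm (\<chi> i. M :: real ^ 3)"
      using cl M(1) L0 by (intro mult_left_mono norm_le_componentwise_cart) auto
    finally show ?thesis .
  qed
  have g: "continuous_on UNIV g"
    using lip L0 by (intro lipschitz_on_continuous_on[of L]) (auto simp: lipschitz_on_def dist_norm)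
  obtain y where y: "caputo_solution_on q g {0..} y" "y 0 = x0"
    using caputo_solution_exists[OF q(1) lip bound] by blast
  have yM: "\<bar>y t $ i\<bar> \<le> M" if "t \<ge> 0" for t i
  proof (rule caputo_solution_in_box[OF q g y(1) _ _ that])
    show "\<bar>y 0 $ i\<bar> < M" for i using x0 y(2) by simp
    show "\<sigma> * g u $ i < 0" if "\<And>j. \<bar>u $ j\<bar> \<le> M" "\<bar>\<sigma>\<bar> = 1" "\<sigma> * u $ i = M" for i \<sigma> u
    proof -
      have "\<sigma> * g u $ i \<le> (M + max c1 c2) * M"
        unfolding g_def cl_id[OF that(1)] using that by (intro controlled_lagrange_inward) auto
      also have "\<dots> < 0" using M by (simp add: mult_neg_pos)
      finally show ?thesis .
    qed
  qed
  have "g (y s) = ?f (y s)" if "s \<ge> 0" for s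
    using yM[OF that] by (simp add: g_def cl_id)
  then have eq: "integral {0..t} (\<lambda>s. (t - s) powr (q - 1) *\<^sub>R g (y s))
      = integral {0..t} (\<lambda>s. (t - s) powr (q - 1) *\<^sub>R ?f (y s))" for t
    by (intro integral_cong) auto
  have "caputo_solution_on q ?f {0..} y"
    using y(1) unfolding caputo_solution_on_def eq .
  then show thesis using that y(2) yM by blast
qed

section \<open>Asymptotic stability\<close>

lemma controlled_lagrange_asymptotically_stable:
  assumes c: "c1 < 0" "c2 < 0" and q: "0 < q" "q < 1"
  shows "asymptotically_stable_equilibrium q (controlled_lagrange c1 c2) 0"
  unfolding asymptotically_stable_equilibrium_def
proof
  let ?f = "controlled_lagrange c1 c2"
  define m where "m = max c1 c2"
  have m: "m < 0" using c by (simp add: m_def)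
  show "stable_equilibrium q ?f 0"
    unfolding stable_equilibrium_def
  proof (intro conjI allI impI equilibrium_controlled_lagrange)
    fix \<epsilon> :: real assume "\<epsilon> > 0"
    \<comment> \<open>The first bound gives norm at most 3 M < \<epsilon> by summing three
      coordinates, the second makes the box invariant.\<close>
    define M where "M = min (\<epsilon> / 4) (- m / 2)"
    have M: "M > 0" "M + max c1 c2 < 0" "3 * M < \<epsilon>"
      using \<open>\<epsilon> > 0\<close> m by (auto simp: M_def m_def[symmetric])
    show "\<exists>\<delta>>0. \<forall>J x. caputo_solution_on q ?f J x \<and> norm (x 0 - 0) < \<delta> \<longrightarrow>
        (\<exists>y. caputo_solution_on q ?f {0..} y \<and> (\<forall>t\<in>J. y t = x t) \<and> (\<forall>t\<ge>0. norm (y t - 0) < \<epsilon>))"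
    proof (intro exI[of _ M] conjI allI impI M(1))
      fix J x assume x: "caputo_solution_on q ?f J x \<and> norm (x 0 - 0) < M"
      then have "\<bar>x 0 $ i\<bar> < M" for i
        using component_le_norm_cart[of "x 0" i] by simp
      then obtain y where y: "caputo_solution_on q ?f {0..} y" "y 0 = x 0"
        "\<And>t i. t \<ge> 0 \<Longrightarrow> \<bar>y t $ i\<bar> \<le> M"
        using controlled_lagrange_global_solution[OF q M(1,2), of "x 0"] by blast
      have J: "is_interval J" "0 \<in> J" "J \<subseteq> {0..}"
        using x unfolding caputo_solution_on_def by blast+
      \<comment> \<open>The restriction of the global solution to \<open>J\<close> is compared with
        the given local one by uniqueness.\<close>
      have "caputo_solution_on q ?f J y"
        using y(1) J continuous_on_subset[of "{0..}" y J] unfolding caputo_solution_on_def by blast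
      then have "\<forall>t\<in>J. y t = x t"
        using x y(2) controlled_lagrange_solution_unique[OF q(1)] by blast
      moreover have "norm (y t - 0) < \<epsilon>" if "t \<ge> 0" for t
      proof -
        have "norm (y t) \<le> (\<Sum>i\<in>UNIV. \<bar>y t $ i\<bar>)" by (rule norm_le_l1_cart)
        also have "\<dots> \<le> (\<Sum>i\<in>(UNIV :: 3 set). M)" by (intro sum_mono y that)
        finally show ?thesis using M(3) by simp
      qed
      ultimately show "\<exists>y. caputo_solution_on q ?f {0..} y \<and> (\<forall>t\<in>J. y t = x t) \<and> (\<forall>t\<ge>0. norm (y t - 0) < \<epsilon>)"
        using y(1) by blast
    qed
  qed
  \<comment> \<open>With this choice M + max c1 c2 = - M, so \<open>M\<close> is also the damping
    rate.\<close>
  define M where "M = - m / 2"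
  have M: "M > 0" "M + max c1 c2 < 0" "M + max c1 c2 = - M"
    using m by (auto simp: M_def m_def[symmetric])
  show "\<exists>\<delta>\<^sub>0>0. \<forall>x. caputo_solution_on q ?f {0..} x \<and> norm (x 0 - 0) < \<delta>\<^sub>0 \<longrightarrow>
      ((\<lambda>t. norm (x t - 0)) \<longlongrightarrow> 0) at_top"
  proof (intro exI[of _ M] conjI allI impI M(1))
    fix x assume x: "caputo_solution_on q ?f {0..} x \<and> norm (x 0 - 0) < M"
    then have "\<bar>x 0 $ i\<bar> < M" for i
      using component_le_norm_cart[of "x 0" i] by simp
    then obtain y where y: "caputo_solution_on q ?f {0..} y" "y 0 = x 0"
      "\<And>t i. t \<ge> 0 \<Longrightarrow> \<bar>y t $ i\<bar> \<le> M"
      using controlled_lagrange_global_solution[OF q M(1,2), of "x 0"] by blast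
    have "x t = y t" if "t \<ge> 0" for t
      using controlled_lagrange_solution_unique[OF q(1) _ y(1)] x y(2) that by simp
    then have xM: "\<bar>x t $ i\<bar> \<le> M" if "t \<ge> 0" for t i
      using y(3) that by simp
    have "((\<lambda>t. norm (x t)) \<longlongrightarrow> 0) at_top"
    proof (rule caputo_solution_tendsto_0[OF q continuous_on_controlled_lagrange _ xM M(1)])
      show "\<sigma> * ?f (x t) $ i \<le> - M * r"
        if "t \<ge> 0" "\<And>j. \<bar>x t $ j\<bar> \<le> r" "\<bar>\<sigma>\<bar> = 1" "\<sigma> * x t $ i = r" for t i \<sigma> r
        using controlled_lagrange_inward[OF xM[OF that(1)] that(2-4), of c1 c2] by (simp add: M(3))
    qed (use x in auto)
    then show "((\<lambda>t. norm (x t - 0)) \<longlongrightarrow> 0) at_top" by simp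
  qed
qed

section \<open>Instability\<close>

text \<open>Positivity of \<open>u\<close> gives u \<ge> a, and inserting this into the equation
  gives u(t) \<ge> a + c a t^q / \<Gamma>(1+q). Mittag-Leffler functions are thus avoided.\<close>

lemma linear_caputo_solution_unbounded:
  fixes u :: "real \<Rightarrow> real"
  assumes q: "q > 0" and "a > 0" "c > 0" and cont: "continuous_on {0..} u"
    and u: "\<And>t. t \<ge> 0 \<Longrightarrow> u t = a + riemann_liouville q (\<lambda>s. c * u s) t"
  shows "\<exists>t\<ge>0. u t > b"
proof -
  have int: "riemann_liouville_integrable q (\<lambda>s. c * u s) t" "riemann_liouville_integrable q (\<lambda>_. k :: real) t" for t k
    by (intro riemann_liouville_integrable_continuous q continuous_intros continuous_on_subset[OF cont]; auto)+
  have ge: "u t \<ge> a" if "t \<ge> 0" "\<And>s. s \<in> {0<..<t} \<Longrightarrow> u s \<ge> 0" for t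
  proof -
    have "riemann_liouville q (\<lambda>_. 0 :: real) t \<le> riemann_liouville q (\<lambda>s. c * u s) t"
      using that \<open>c > 0\<close> by (intro riemann_liouville_mono q int) auto
    then show ?thesis using u[OF that(1)] riemann_liouville_const[OF q that(1), of 0] by simp
  qed
  have pos: "u t > 0" if "t \<ge> 0" for t
  proof (rule ccontr)
    assume "\<not> u t > 0"
    \<comment> \<open>Before the first time with u \<le> 0 the integrand is nonnegative, so
      \<open>ge\<close> yields u \<ge> a > 0 at that very time.\<close>
    define S where "S = {s \<in> {0..}. u s \<le> 0}"
    have "S \<noteq> {}" using \<open>\<not> u t > 0\<close> that by (auto simp: S_def)
    moreover have bdd: "bdd_below S" by (rule bdd_belowI[of _ 0]) (auto simp: S_def)
    moreover have "S = {0..} \<inter> u -` {..0}" by (auto simp: S_def)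
    then have "closed S"
      using continuous_closed_preimage[OF cont closed_atLeast closed_atMost] by simp
    ultimately have T: "Inf S \<in> S" by (rule closed_contains_Inf)
    have "u s \<ge> 0" if "s \<in> {0<..<Inf S}" for s
      using cInf_lower[OF _ bdd, of s] that by (force simp: S_def)
    then have "u (Inf S) \<ge> a" using T by (intro ge) (auto simp: S_def)
    then show False using T \<open>a > 0\<close> by (simp add: S_def)
  qed
  then have ua: "u t \<ge> a" if "t \<ge> 0" for t
    using that by (intro ge) (auto intro: less_imp_le)
  define k where "k = c * a / Gamma (1 + q)"
  have k: "k > 0" using assms by (simp add: k_def)
  \<comment> \<open>Solves k t^q = \<open>\<bar>b\<bar>\<close>, so that u(t) \<ge> a +
    \<open>\<bar>b\<bar>\<close> > b.\<close>
  define t where "t = (\<bar>b\<bar> / k) powr (1 / q)"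
  have t: "t \<ge> 0" by (simp add: t_def)
  have "k * t powr q = \<bar>b\<bar>"
    using k q by (simp add: t_def powr_powr)
  moreover have "k * t powr q = riemann_liouville q (\<lambda>_. c * a) t"
    using riemann_liouville_const[OF q t] by (simp add: k_def)
  moreover have "\<dots> \<le> riemann_liouville q (\<lambda>s. c * u s) t"
    using ua \<open>c > 0\<close> by (intro riemann_liouville_mono q int) auto
  ultimately have "u t > b" using u[OF t] \<open>a > 0\<close> by linarith
  then show ?thesis using t by blast
qed

text \<open>On the coordinate axis \<open>i\<close> the quadratic terms vanish and the system
  becomes D^q u = c u. A solution starting on that axis arbitrarily close to the origin is therefore
  unbounded, contradicting stability with \<epsilon> = 1.\<close>

lemma controlled_lagrange_unstable:
  fixes i :: 3
  assumes q: "q > 0" and c: "i = 1 \<and> c = c1 \<or> i = 2 \<and> c = c2" "c > 0"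
  shows "unstable_equilibrium q (controlled_lagrange c1 c2) 0"
  unfolding unstable_equilibrium_def
proof (intro conjI notI equilibrium_controlled_lagrange)
  let ?f = "controlled_lagrange c1 c2"
  assume "stable_equilibrium q ?f 0"
  then obtain \<delta> where \<delta>: "\<delta> > 0" "\<And>J x. caputo_solution_on q ?f J x \<Longrightarrow> norm (x 0) < \<delta> \<Longrightarrow>
      \<exists>y. caputo_solution_on q ?f {0..} y \<and> (\<forall>t\<in>J. y t = x t) \<and> (\<forall>t\<ge>0. norm (y t) < 1)"
    unfolding stable_equilibrium_def by (metis diff_zero zero_less_one)
  define x0 where "x0 = axis i (\<delta> / 2)"
  \<comment> \<open>The degenerate interval makes assumed stability itself supply a global solution
    from \<open>x0\<close>, bounded by 1.\<close>
  have "caputo_solution_on q ?f {0} (\<lambda>_. x0)"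
    using is_interval_cc[of 0 "0::real"] unfolding caputo_solution_on_def by simp
  moreover have "norm x0 < \<delta>" using \<delta>(1) by (simp add: x0_def norm_eq_sqrt_inner inner_axis_axis real_sqrt_divide)
  ultimately obtain y where y: "caputo_solution_on q ?f {0..} y" "y 0 = x0" "\<And>t. t \<ge> 0 \<Longrightarrow> norm (y t) < 1"
    using \<delta>(2)[of "{0}" "\<lambda>_. x0"] by auto
  \<comment> \<open>Flipping the sign of two coordinates is a symmetry of the system, so by uniqueness the
    coordinate axis is invariant.\<close>
  define R :: "real ^ 3 \<Rightarrow> real ^ 3" where "R u = (\<chi> j. if j = i then u $ j else - u $ j)" for u
  have R: "linear R"
    by (rule linearI) (auto simp: R_def vec_eq_iff)
  have fR: "?f (R u) = R (?f u)" for u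
    using c(1) by (auto simp: vec_eq_iff forall_3 R_def controlled_lagrange_component)
  have yc: "continuous_on {0..} y"
    using y(1) unfolding caputo_solution_on_def by blast
  have fy: "riemann_liouville_integrable q (\<lambda>s. ?f (y s)) t" for t
    by (intro riemann_liouville_integrable_continuous q
        continuous_on_compose2[OF continuous_on_controlled_lagrange[of UNIV]] continuous_on_subset[OF yc]) auto
  have Ry: "caputo_solution_on q ?f {0..} (\<lambda>t. R (y t))"
    unfolding caputo_solution_on_iff[OF q continuous_on_controlled_lagrange]
  proof (intro conjI ballI)
    show "continuous_on {0..} (\<lambda>t. R (y t))"
      by (rule linear_continuous_on_compose[OF yc R])
    fix t :: real assume "t \<in> {0..}"
    then have "y t = y 0 + riemann_liouville q (\<lambda>s. ?f (y s)) t"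
      using y(1) unfolding caputo_solution_on_iff[OF q continuous_on_controlled_lagrange] by blast
    then have "R (y t) = R (y 0 + riemann_liouville q (\<lambda>s. ?f (y s)) t)"
      by (rule arg_cong)
    also have "\<dots> = R (y 0) + R (riemann_liouville q (\<lambda>s. ?f (y s)) t)"
      by (rule linear_add[OF R])
    also have "R (riemann_liouville q (\<lambda>s. ?f (y s)) t) = riemann_liouville q (\<lambda>s. ?f (R (y s))) t"
      unfolding fR by (rule riemann_liouville_linear(2)[OF fy R, symmetric])
    finally show "R (y t) = R (y 0) + riemann_liouville q (\<lambda>s. ?f (R (y s))) t" .
  qed (auto simp: is_interval_ci)
  have "R (y 0) = y 0" by (auto simp: y(2) x0_def R_def vec_eq_iff axis_def)
  then have Ryt: "R (y t) = y t" if "t \<ge> 0" for t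
    using controlled_lagrange_solution_unique[OF q Ry y(1)] that by simp
  have y0: "y t $ j = 0" if "t \<ge> 0" "j \<noteq> i" for t j
    using arg_cong[OF Ryt[OF that(1)], of "\<lambda>u. u $ j"] that(2) by (simp add: R_def)
  have "?f (y t) $ i = c * y t $ i" if "t \<ge> 0" for t
    using c(1) y0[OF that] by (auto simp: controlled_lagrange_component)
  then have rl: "riemann_liouville q (\<lambda>s. ?f (y s) $ i) t = riemann_liouville q (\<lambda>s. c * y s $ i) t" for t
    unfolding riemann_liouville_def by (intro arg_cong[of _ _ "(*\<^sub>R) _"] set_lebesgue_integral_cong) auto
  have "y t $ i = \<delta> / 2 + riemann_liouville q (\<lambda>s. c * y s $ i) t" if "t \<ge> 0" for t
    using caputo_solution_component[OF q continuous_on_controlled_lagrange y(1) that, of i]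
    unfolding rl by (simp add: y(2) x0_def)
  moreover have "continuous_on {0..} (\<lambda>t. y t $ i)" by (intro continuous_intros yc)
  ultimately obtain t where "t \<ge> 0" "y t $ i > 1"
    using linear_caputo_solution_unbounded[OF q _ c(2), of "\<delta> / 2" "\<lambda>t. y t $ i" 1] \<delta>(1) by auto
  then show False
    using y(3)[of t] component_le_norm_cart[of "y t" i] by simp
qed

theorem proposition3p1:
  fixes c1 c2 :: real
  shows "(c1 < 0 \<and> c2 < 0 \<longrightarrow>
            (\<forall>q\<in>{0<..<1}. asymptotically_stable_equilibrium q (controlled_lagrange c1 c2) 0)) \<and>
         ((c1 > 0 \<and> c2 > 0) \<or> c1 * c2 < 0 \<longrightarrow>
            (\<forall>q\<in>{0<..<1}. unstable_equilibrium q (controlled_lagrange c1 c2) 0))"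
proof (intro conjI impI ballI)
  fix q :: real assume "c1 < 0 \<and> c2 < 0" "q \<in> {0<..<1}"
  then show "asymptotically_stable_equilibrium q (controlled_lagrange c1 c2) 0"
    by (intro controlled_lagrange_asymptotically_stable) auto
next
  fix q :: real assume c: "(c1 > 0 \<and> c2 > 0) \<or> c1 * c2 < 0" and q: "q \<in> {0<..<1}"
  then have "c1 > 0 \<or> c2 > 0" by (auto simp: mult_less_0_iff)
  then show "unstable_equilibrium q (controlled_lagrange c1 c2) 0"
    using controlled_lagrange_unstable[of q 1 c1 c1 c2] controlled_lagrange_unstable[of q 2 c2 c1 c2] q
    by auto
qed

end
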